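(* Let $p\in(0,1)$ be a constant. Then for every $\varepsilon>0$, $$\lim_{\substack{n\to\infty\\ n \text{ odd}}}\ \mathbb{P}\Big(\big|\chi_g^{\infty}(G_{n,p})-\tfrac{pn}{2}\big|\le \varepsilon n\Big)=1,$$ i.e. for odd $n$, with high probability $\chi_g^{\infty}(G_{n,p})=(1+o(1))\frac{pn}{2}$.
   Context: $G_{n,p}$ is the Erdős–Rényi random graph on $n$ vertices, each edge present independently with probability $p$. The eternal vertex colouring game on a graph $G$ with colour set $\{1,\dots,k\}$ is played by Alice and Bob, who alternately choose vertices, Alice making the very first move; the game consists of rounds, and in each round every vertex is chosen exactly once. In the first round, a player chooses a vertex not yet coloured and assigns it a colour so that the resulting partial colouring is proper. In every later round, players keep alternating (so the player who starts a round is determined by parity), each choosing a vertex not yet chosen in the current round and assigning it a colour different from its current colour such that the resulting colouring is proper; vertices keep their colour until recoloured. Bob wins if at some point the chosen vertex has no legal colour; Alice wins if the game continues indefinitely. $\chi_g^{\infty}(G)$, the eternal game chromatic number, is the smallest $k$ for which Alice has a winning strategy. *)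

theory Defs
  imports "HOL-Probability.Probability" "HOL-Library.Ramsey"
begin

section \<open>The eternal vertex colouring game\<close>

text \<open>
  A finite simple graph is given by its vertex set \<open>V\<close> and its edge set \<open>E \<subseteq> [V]\<^bsup>2\<^esup>\<close>, a set of
  two-element sets of vertices. A move is a vertex together with the colour it receives, and
  a history is the list of all moves made so far, in chronological order. Each round
  consists of \<open>card V\<close> moves, and Alice is to move exactly after the histories of even length.
\<close>

type_synonym 'a move = "'a \<times> nat"
type_synonym 'a history = "'a move list"

text \<open>The partial colouring on the board: every vertex carries the colour of its latest move.\<close>

definition colouring :: "'a history \<Rightarrow> 'a \<Rightarrow> nat option" where
  "colouring h = map_of (rev h)"

definition chosen_this_round :: "'a set \<Rightarrow> 'a history \<Rightarrow> 'a set" where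
  "chosen_this_round V h = fst ` set (drop (length h div card V * card V) h)"

text \<open>
  In the first round a vertex has been chosen exactly if it is coloured, so that
  \<open>available\<close> covers the rule of the first round as well as that of the later ones.
\<close>

definition available :: "'a set \<Rightarrow> 'a history \<Rightarrow> 'a \<Rightarrow> bool" where
  "available V h v \<longleftrightarrow> v \<in> V \<and> v \<notin> chosen_this_round V h"

definition proper :: "'a set set \<Rightarrow> ('a \<Rightarrow> nat option) \<Rightarrow> bool" where
  "proper E f \<longleftrightarrow> (\<forall>u v. {u, v} \<in> E \<longrightarrow> u \<in> dom f \<longrightarrow> v \<in> dom f \<longrightarrow> f u \<noteq> f v)"

text \<open>The second conjunct holds trivially as long as \<open>v\<close> is uncoloured, that is, in the first round.\<close>

definition legal_colour :: "'a set set \<Rightarrow> nat \<Rightarrow> 'a history \<Rightarrow> 'a \<Rightarrow> nat \<Rightarrow> bool" where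
  "legal_colour E k h v c \<longleftrightarrow>
     c \<in> {1..k} \<and> colouring h v \<noteq> Some c \<and> proper E ((colouring h)(v \<mapsto> c))"

definition legal_move :: "'a set \<Rightarrow> 'a set set \<Rightarrow> nat \<Rightarrow> 'a history \<Rightarrow> 'a move \<Rightarrow> bool" where
  "legal_move V E k h m \<longleftrightarrow> available V h (fst m) \<and> legal_colour E k h (fst m) (snd m)"

text \<open>
  A player may choose an available vertex that has no legal colour; the game then stops and
  Bob wins.
\<close>

definition stuck :: "'a set \<Rightarrow> 'a set set \<Rightarrow> nat \<Rightarrow> 'a history \<Rightarrow> 'a \<Rightarrow> bool" where
  "stuck V E k h v \<longleftrightarrow> available V h v \<and> (\<nexists>c. legal_colour E k h v c)"

text \<open>The histories that can arise when Alice follows the strategy \<open>\<sigma>\<close>.\<close>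

inductive follows ::
  "'a set \<Rightarrow> 'a set set \<Rightarrow> nat \<Rightarrow> ('a history \<Rightarrow> 'a move) \<Rightarrow> 'a history \<Rightarrow> bool"
  for V :: "'a set" and E :: "'a set set" and k :: nat and \<sigma> :: "'a history \<Rightarrow> 'a move"
where
  start: "follows V E k \<sigma> []"
| alice: "follows V E k \<sigma> h \<Longrightarrow> even (length h) \<Longrightarrow> legal_move V E k h (\<sigma> h) \<Longrightarrow>
    follows V E k \<sigma> (h @ [\<sigma> h])"
| bob: "follows V E k \<sigma> h \<Longrightarrow> odd (length h) \<Longrightarrow> legal_move V E k h m \<Longrightarrow>
    follows V E k \<sigma> (h @ [m])"

text \<open>
  Alice wins a play if it continues indefinitely. For nonempty \<open>V\<close> some vertex is always
  available, so a play ends only when a stuck vertex is chosen. Hence \<open>\<sigma>\<close> is winning if it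
  always provides a legal move and Bob is never able to choose a stuck vertex.
\<close>

definition winning_strategy ::
  "'a set \<Rightarrow> 'a set set \<Rightarrow> nat \<Rightarrow> ('a history \<Rightarrow> 'a move) \<Rightarrow> bool" where
  "winning_strategy V E k \<sigma> \<longleftrightarrow>
     (\<forall>h. follows V E k \<sigma> h \<longrightarrow>
        (even (length h) \<longrightarrow> legal_move V E k h (\<sigma> h)) \<and>
        (odd (length h) \<longrightarrow> (\<nexists>v. stuck V E k h v)))"

definition eternal_game_chromatic_number :: "'a set \<Rightarrow> 'a set set \<Rightarrow> nat" where
  "eternal_game_chromatic_number V E = (LEAST k. \<exists>\<sigma>. winning_strategy V E k \<sigma>)"


section \<open>The Erdos-Renyi random graph\<close>

text \<open>
  The random edge set of \<open>G\<^bsub>n,p\<^esub>\<close> on the vertex set \<open>{..<n}\<close>: one independent Bernoulli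
  variable with parameter \<open>p\<close> for each of the potential edges \<open>[{..<n}]\<^bsup>2\<^esup>\<close>.
\<close>

definition random_graph :: "nat \<Rightarrow> real \<Rightarrow> nat set set pmf" where
  "random_graph n p =
     map_pmf (\<lambda>X. {e \<in> [{..<n}]\<^bsup>2\<^esup>. X e})
       (Pi_pmf ([{..<n}]\<^bsup>2\<^esup>) False (\<lambda>_. bernoulli_pmf p))"

end

theory Submission
  imports Defs "HOL-Real_Asymp.Real_Asymp"
begin

text \<open>
  Upper bound. With \<open>(p/2 + \<epsilon>)n\<close> colours, a typical graph has the following property: whatever the
  partial colouring, only \<open>O(n\<^sup>1\<^sup>/\<^sup>3)\<close> vertices see almost all colours of a fixed small linear palette,
  because most colour classes of the palette have bounded size. Alice recolours such low vertices
  as soon as possible, which costs her \<open>o(n)\<close> moves per round, and otherwise she plays a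
  palette colour on the vertex that reduces an exponential potential most. The potential forces
  Bob's share of each neighbourhood to be at most half of it up to \<open>o(n)\<close> by the end of the
  round, so that at the beginning of the next round every vertex misses many colours.

  Lower bound. Bob targets the vertex \<open>v\<close> that Alice colours first and spends the first round on
  placing all other colours in the neighbourhood of \<open>v\<close>. As \<open>n\<close> is odd, Bob opens the second
  round, where \<open>v\<close> has no legal colour. Alice can only interfere by using a new colour outside
  the neighbourhood of \<open>v\<close>, which Bob answers by using that colour inside it. The answer is
  impossible only if the colour already dominates the uncoloured neighbours of \<open>v\<close>; few disjoint
  pairs of vertices nearly dominate a linear set, and Bob disarms them by colouring their vertices himself.
\<close>

section \<open>Graphs and histories\<close>

text \<open>Both strategies must cope with every partial colouring, and there are exp(O(n log n)) of
  them, so bad events need probability about exp(-n^(5/4)). One property, \<open>scattered\<close>,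
  achieves this for both players: z = n^(1/3) objects against linearly many others involve order
  n^(4/3) independent events. For Alice these are z low vertices against small colour classes, for
  Bob linearly many vertices against z pairs. The value of z fixes the other scales. With
  \<open>Ep\<close> and \<open>\<tau>\<close> of order n^(1/2), an epoch is long enough for Alice to
  treat z vertices, z treatments per epoch make O(n^(5/6)) moves per round, and z vertices that miss
  few palette colours miss only o(n) of them together. A vertex found low at a check still misses
  \<open>A\<close> colours, since the check before found it with \<open>\<tau>\<close>. Bob's
  difficulty is that one move of Alice can shrink the reserves of many pairs at once. Charging all
  trouble to a potential that starts at \<open>8 * z + 1\<close> bounds the exchanges that bring no
  new colour next to \<open>v\<close> by o(n), so that half of the degree of \<open>v\<close> still
  suffices for all colours.\<close>

definition nbhd :: "'a set set \<Rightarrow> 'a \<Rightarrow> 'a set" where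
  "nbhd E v = {u. {v, u} \<in> E}"

text \<open>Legality on a board that is already proper: only the moved vertex needs checking. The
  ban on its own colour is vacuous while it is uncoloured, so one form serves all rounds.\<close>

definition can_take :: "'a set set \<Rightarrow> nat \<Rightarrow> ('a \<Rightarrow> nat option) \<Rightarrow> 'a \<Rightarrow> nat \<Rightarrow> bool" where
  "can_take E k f v c \<longleftrightarrow> c \<in> {1..k} \<and> f v \<noteq> Some c \<and> (\<forall>x\<in>nbhd E v. f x \<noteq> Some c)"

locale fin_graph =
  fixes V :: "'a set" and E :: "'a set set"
  assumes finV: "finite V" and E: "E \<subseteq> [V]\<^bsup>2\<^esup>"
begin

lemma nbhd_sym: "x \<in> nbhd E v \<longleftrightarrow> v \<in> nbhd E x"
  by (simp add: nbhd_def insert_commute)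

lemma nbhd_subset: "nbhd E v \<subseteq> V"
  using E by (auto simp: nbhd_def)

lemma nbhd_irrefl: "v \<notin> nbhd E v"
  using E by (auto simp: nbhd_def nsets_def)

lemma finite_nbhd: "finite (nbhd E v)"
  using nbhd_subset finV by (rule finite_subset)

lemma proper_iff: "proper E f \<longleftrightarrow> (\<forall>u. \<forall>x\<in>nbhd E u. \<forall>c. f u = Some c \<longrightarrow> f x \<noteq> Some c)"
  unfolding proper_def nbhd_def by (auto simp: dom_def) metis

lemma proper_upd_iff:
  assumes "proper E f"
  shows "proper E (f(v \<mapsto> c)) \<longleftrightarrow> (\<forall>x\<in>nbhd E v. f x \<noteq> Some c)"
proof
  assume "proper E (f(v \<mapsto> c))"
  then show "\<forall>x\<in>nbhd E v. f x \<noteq> Some c"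
    unfolding proper_iff using nbhd_irrefl by (metis fun_upd_apply)
next
  assume *: "\<forall>x\<in>nbhd E v. f x \<noteq> Some c"
  show "proper E (f(v \<mapsto> c))"
    using assms * nbhd_sym nbhd_irrefl unfolding proper_iff by (auto simp: fun_upd_apply)
qed

lemma legal_colour_iff:
  assumes "proper E (colouring h)"
  shows "legal_colour E k h v c \<longleftrightarrow> can_take E k (colouring h) v c"
  using proper_upd_iff[OF assms] by (auto simp: legal_colour_def can_take_def)

lemma proper_upd: "proper E f \<Longrightarrow> can_take E k f v c \<Longrightarrow> proper E (f(v \<mapsto> c))"
  by (simp add: proper_upd_iff can_take_def)

end

lemma colouring_Nil [simp]: "colouring [] = Map.empty"
  by (simp add: colouring_def)

lemma colouring_snoc: "colouring (h @ [m]) = (colouring h)(fst m \<mapsto> snd m)"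
  by (cases m) (simp add: colouring_def)

lemma dom_colouring: "dom (colouring h) = fst ` set h"
  by (simp add: colouring_def dom_map_of_conv_image_fst)

lemma chosen_Nil [simp]: "chosen_this_round V [] = {}"
  by (simp add: chosen_this_round_def)

lemma chosen_snoc:
  assumes "card V > 0"
  shows "chosen_this_round V (h @ [m]) =
    (if Suc (length h) mod card V = 0 then {} else insert (fst m) (chosen_this_round V h))"
proof (cases "Suc (length h) mod card V = 0")
  case True
  then have "Suc (length h) div card V * card V = Suc (length h)" by (simp add: mod_eq_0_iff_dvd)
  with True show ?thesis by (simp add: chosen_this_round_def)
next
  case False
  then have "Suc (length h) div card V = length h div card V" by (simp add: div_Suc)
  moreover have "length h div card V * card V \<le> length h" by simp
  ultimately show ?thesis using False by (simp add: chosen_this_round_def)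
qed

text \<open>The strategy picks, by choice, any legal move that preserves \<open>Inv\<close>;
  induction over \<open>follows\<close> keeps all its plays inside \<open>Inv\<close>.\<close>

lemma winning_strategyI:
  assumes "Inv []"
    and "\<And>h. Inv h \<Longrightarrow> even (length h) \<Longrightarrow> \<exists>m. legal_move V E k h m \<and> Inv (h @ [m])"
    and "\<And>h v. Inv h \<Longrightarrow> odd (length h) \<Longrightarrow> \<not> stuck V E k h v"
    and "\<And>h m. Inv h \<Longrightarrow> odd (length h) \<Longrightarrow> legal_move V E k h m \<Longrightarrow> Inv (h @ [m])"
  shows "\<exists>\<sigma>. winning_strategy V E k \<sigma>"
proof -
  define \<sigma> where "\<sigma> h = (SOME m. legal_move V E k h m \<and> Inv (h @ [m]))" for h
  have \<sigma>: "legal_move V E k h (\<sigma> h) \<and> Inv (h @ [\<sigma> h])" if "Inv h" "even (length h)" for h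
    unfolding \<sigma>_def using assms(2)[OF that] by (rule someI_ex)
  have "Inv h" if "follows V E k \<sigma> h" for h
    using that by induction (use assms \<sigma> in auto)
  then have "winning_strategy V E k \<sigma>"
    unfolding winning_strategy_def using \<sigma> assms by blast
  then show ?thesis by blast
qed

section \<open>Alice wins with enough colours\<close>

text \<open>
  Alice's own colours come from the palette \<open>{1..K}\<close>. A vertex is low if it misses fewer than
  \<open>\<tau>\<close> palette colours. A round is divided into epochs of \<open>Ep\<close> moves, and \<open>A\<close> colours are missing
  at every vertex when a round starts.
\<close>

locale upper_game = fin_graph V E for V :: "'a set" and E +
  fixes k K A \<tau> Ep z :: nat and l :: real
  assumes V: "V \<noteq> {}" and K: "K \<le> k" "\<tau> \<le> K"
    and l: "0 < l" "l < 1"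
    and A: "2 * z + 4 \<le> A" and Ep: "2 * z + 1 < Ep" and \<tau>: "A + Ep \<le> \<tau>"
    and few_low: "\<And>f. dom f \<subseteq> V \<Longrightarrow>
      card {v \<in> V. card ({1..K} - {c. \<exists>x\<in>nbhd E v. f x = Some c}) < \<tau>} \<le> z"
    and balance: "\<And>v a b w. v \<in> V \<Longrightarrow> a + b = card (nbhd E v) \<Longrightarrow> w \<le> z * (card V div Ep + 1) \<Longrightarrow>
      (1 + l) ^ b * (1 - l) ^ a \<le> real (card V) * (1 + l) ^ (w + 1) \<Longrightarrow> b + K + w + A \<le> k"
begin

section \<open>The exponential potential\<close>

definition seen :: "('a \<Rightarrow> nat option) \<Rightarrow> 'a \<Rightarrow> nat set" where
  "seen f v = {c. \<exists>x\<in>nbhd E v. f x = Some c}"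

text \<open>A multiplicative-weights potential: it is large where Bob leads Alice in the
  neighbourhood of \<open>v\<close>. A move at \<open>x\<close> multiplies the weights of the
  neighbours of \<open>x\<close> by \<open>1 + l\<close> or \<open>1 - l\<close>, which makes its
  effect linear in \<open>gain\<close>.\<close>

definition weight :: "'a set \<Rightarrow> 'a set \<Rightarrow> 'a \<Rightarrow> real" where
  "weight CA CB v = (1 + l) ^ card (CB \<inter> nbhd E v) * (1 - l) ^ card (CA \<inter> nbhd E v)"

definition potential :: "'a set \<Rightarrow> 'a set \<Rightarrow> real" where
  "potential CA CB = (\<Sum>v\<in>V. weight CA CB v)"

definition gain :: "'a set \<Rightarrow> 'a set \<Rightarrow> 'a \<Rightarrow> real" where
  "gain CA CB x = (\<Sum>v\<in>nbhd E x. weight CA CB v)"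

lemma weight_pos: "0 < weight CA CB v"
  using l by (simp add: weight_def)

lemma card_insert_nbhd:
  assumes "x \<notin> C" "finite C"
  shows "card (insert x C \<inter> nbhd E v) = (if v \<in> nbhd E x then Suc (card (C \<inter> nbhd E v)) else card (C \<inter> nbhd E v))"
  using assms nbhd_sym[of x v] by (auto simp: Int_insert_left)

lemma weight_insert_B:
  assumes "x \<notin> CB" "finite CB"
  shows "weight CA (insert x CB) v = weight CA CB v + (if v \<in> nbhd E x then l * weight CA CB v else 0)"
  using card_insert_nbhd[OF assms, of v] by (simp add: weight_def algebra_simps)

lemma weight_insert_A:
  assumes "x \<notin> CA" "finite CA"
  shows "weight (insert x CA) CB v = weight CA CB v - (if v \<in> nbhd E x then l * weight CA CB v else 0)"
  using card_insert_nbhd[OF assms, of v] by (simp add: weight_def algebra_simps)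

lemma sum_nbhd: "(\<Sum>v\<in>V. if v \<in> nbhd E x then g v else 0) = (\<Sum>v\<in>nbhd E x. g v :: real)"
  using nbhd_subset[of x] finV by (simp add: sum.If_cases Int_absorb1)

lemma potential_insert_B:
  assumes "x \<notin> CB" "finite CB"
  shows "potential CA (insert x CB) = potential CA CB + l * gain CA CB x"
  unfolding potential_def gain_def
  by (simp add: weight_insert_B[OF assms] sum.distrib sum_nbhd sum_distrib_left)

lemma potential_insert_A:
  assumes "x \<notin> CA" "finite CA"
  shows "potential (insert x CA) CB = potential CA CB - l * gain CA CB x"
  unfolding potential_def gain_def
  by (simp add: weight_insert_A[OF assms] sum_subtractf sum_nbhd sum_distrib_left)

lemma gain_nonneg: "0 \<le> gain CA CB x"
  unfolding gain_def by (intro sum_nonneg less_imp_le weight_pos)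

lemma gain_le_potential: "gain CA CB x \<le> potential CA CB"
  unfolding gain_def potential_def
  by (intro sum_mono2 finV nbhd_subset less_imp_le weight_pos)

lemma gain_insert_A:
  assumes "y \<notin> CA" "finite CA"
  shows "gain (insert y CA) CB x \<le> gain CA CB x"
  unfolding gain_def
  using weight_insert_A[OF assms] weight_pos l by (intro sum_mono) (auto intro: less_imp_le)

text \<open>
  \<open>C\<close> is the set of vertices chosen in the current round, by Alice (\<open>CA\<close>) and by Bob (\<open>CB\<close>);
  \<open>a\<close> tells whether Alice is to move. The set \<open>Q\<close> contains the vertices that were low when the
  current epoch started, \<open>e\<close> moves ago; \<open>j\<close> epochs of the round are complete, and Alice has
  spent \<open>w\<close> moves of the round on low vertices.
\<close>

definition core ::
  "bool \<Rightarrow> ('a \<Rightarrow> nat option) \<Rightarrow> 'a set \<Rightarrow> 'a set \<Rightarrow> 'a set \<Rightarrow> 'a set \<Rightarrow> nat \<Rightarrow> nat \<Rightarrow> nat \<Rightarrow> bool" where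
  "core a f C CA CB Q e j w \<longleftrightarrow>
     proper E f \<and> dom f \<subseteq> V \<and> C \<subseteq> dom f \<and> C = CA \<union> CB \<and> CA \<inter> CB = {} \<and> Q \<subseteq> V \<and>
     (\<forall>v\<in>V - C. (v \<in> Q \<longrightarrow> A \<le> card ({1..k} - seen f v) + e) \<and>
                (v \<notin> Q \<longrightarrow> \<tau> \<le> card ({1..K} - seen f v) + e)) \<and>
     (Q \<subseteq> C \<or> 2 * card (Q - C) + e \<le> 2 * z + (if a then 1 else 0)) \<and>
     card C = j * Ep + e \<and> w + card (Q - C) \<le> z * (j + 1) \<and> e \<le> Ep \<and>
     card (f ` CA - Some ` {1..K}) \<le> w \<and>
     potential CA CB \<le> real (card V) * (1 + l) ^ (w + 1) \<and>
     (\<not> a \<longrightarrow> (\<forall>x\<in>V - C. potential CA (insert x CB) \<le> real (card V) * (1 + l) ^ (w + 1)))"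

lemma coreD:
  assumes "core a f C CA CB Q e j w"
  shows "proper E f" "dom f \<subseteq> V" "C \<subseteq> dom f" "C = CA \<union> CB" "CA \<inter> CB = {}" "Q \<subseteq> V"
    "\<And>v. v \<in> V - C \<Longrightarrow> v \<in> Q \<Longrightarrow> A \<le> card ({1..k} - seen f v) + e"
    "\<And>v. v \<in> V - C \<Longrightarrow> v \<notin> Q \<Longrightarrow> \<tau> \<le> card ({1..K} - seen f v) + e"
    "Q \<subseteq> C \<or> 2 * card (Q - C) + e \<le> 2 * z + (if a then 1 else 0)"
    "card C = j * Ep + e" "w + card (Q - C) \<le> z * (j + 1)" "e \<le> Ep"
    "card (f ` CA - Some ` {1..K}) \<le> w"
    "potential CA CB \<le> real (card V) * (1 + l) ^ (w + 1)"
    "\<not> a \<Longrightarrow> x \<in> V - C \<Longrightarrow> potential CA (insert x CB) \<le> real (card V) * (1 + l) ^ (w + 1)"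
    "C \<subseteq> V" "finite C" "finite CA" "finite CB"
proof -
  show "C \<subseteq> V" using assms by (auto simp: core_def)
  then show "finite C" using finV finite_subset by auto
  moreover have "C = CA \<union> CB" using assms by (simp add: core_def)
  ultimately show "finite CA" "finite CB" by auto
qed (use assms[unfolded core_def] in \<open>blast+\<close>)

section \<open>Single moves within an epoch\<close>

lemma finite_seen: "finite (seen f v)"
proof -
  have "seen f v \<subseteq> the ` f ` nbhd E v" by (force simp: seen_def)
  then show ?thesis using finite_nbhd finite_subset by blast
qed

lemma card_seen_upd: "card ({1..m} - seen f v) \<le> card ({1..m} - seen (f(y \<mapsto> c)) v) + 1"
proof -
  have "{1..m} - seen f v \<subseteq> insert c ({1..m} - seen (f(y \<mapsto> c)) v)"
    by (auto simp: seen_def split: if_splits)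
  then have "card ({1..m} - seen f v) \<le> card (insert c ({1..m} - seen (f(y \<mapsto> c)) v))"
    by (intro card_mono) auto
  also have "\<dots> \<le> card ({1..m} - seen (f(y \<mapsto> c)) v) + 1" by (simp add: card_insert_if)
  finally show ?thesis .
qed

lemma card_seen_palette: "card ({1..K} - seen f v) \<le> card ({1..k} - seen f v)"
  using K by (intro card_mono) auto

text \<open>Two missing colours are wanted because one of them may be the vertex's own. Outside
  \<open>Q\<close>, at most \<open>Ep\<close> of \<open>\<tau>\<close> palette colours were lost in
  this epoch. A vertex of \<open>Q\<close> can still be available only during the first
  \<open>2 * z + 1\<close> moves of the epoch, which cannot use up its \<open>A\<close>
  colours.\<close>

lemma core_available:
  assumes "core a f C CA CB Q e j w" "v \<in> V - C"
  shows "2 \<le> card ({1..k} - seen f v)" "v \<notin> Q \<Longrightarrow> 2 \<le> card ({1..K} - seen f v)"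
proof -
  note D = coreD[OF assms(1)]
  show 1: "2 \<le> card ({1..K} - seen f v)" if "v \<notin> Q"
    using D(8)[OF assms(2) that] D(12) \<tau> A by linarith
  show "2 \<le> card ({1..k} - seen f v)"
  proof (cases "v \<in> Q")
    case True
    then have "\<not> Q \<subseteq> C" using assms(2) by auto
    then have "e \<le> 2 * z + 1" using D(9) by (auto split: if_splits)
    then show ?thesis using D(7)[OF assms(2) True] A by linarith
  next
    case False
    then show ?thesis using 1 card_seen_palette[of f v] by linarith
  qed
qed

lemma ex_can_take:
  assumes "2 \<le> card ({1..m} - seen f v)" "m \<le> k"
  shows "\<exists>c\<in>{1..m}. can_take E k f v c"
proof -
  have "\<not> {1..m} - seen f v \<subseteq> {the (f v)}"
    using assms(1) card_mono[of "{the (f v)}" "{1..m} - seen f v"] by auto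
  then obtain c where "c \<in> {1..m}" "c \<notin> seen f v" "c \<noteq> the (f v)" by blast
  then show ?thesis using assms(2) by (intro bexI[of _ c]) (auto simp: can_take_def seen_def)
qed

lemma core_bob:
  assumes "core False f C CA CB Q e j w" "e < Ep" "y \<in> V - C" "can_take E k f y c"
  shows "core True (f(y \<mapsto> c)) (insert y C) CA (insert y CB) Q (Suc e) j w"
proof -
  note D = coreD[OF assms(1)]
  have 1: "card (Q - insert y C) \<le> card (Q - C)"
    using D(6) finV by (intro card_mono) (auto intro: finite_subset)
  have 2: "(f(y \<mapsto> c)) ` CA = f ` CA" using D(4) assms(3) by (intro image_cong) auto
  have 3: "card ({1..m} - seen f v) + e \<le> card ({1..m} - seen (f(y \<mapsto> c)) v) + Suc e" for m v
    using card_seen_upd[of m f v y c] by simp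
  show ?thesis
    unfolding core_def
  proof (intro conjI)
    show "\<forall>v\<in>V - insert y C. (v \<in> Q \<longrightarrow> A \<le> card ({1..k} - seen (f(y \<mapsto> c)) v) + Suc e) \<and>
                (v \<notin> Q \<longrightarrow> \<tau> \<le> card ({1..K} - seen (f(y \<mapsto> c)) v) + Suc e)"
      using D(7,8) 3 by (blast intro: order_trans)
    \<comment> \<open>Bob's move raises \<open>e\<close> without reducing \<open>Q - C\<close>. The
      extra 1 granted when Alice is to move absorbs this, and her removal of a member of
      \<open>Q\<close> (2 against 1 on the left) gives it back.\<close>
    show "Q \<subseteq> insert y C \<or> 2 * card (Q - insert y C) + Suc e \<le> 2 * z + (if True then 1 else 0)"
      using D(9) 1 by auto
    show "potential CA (insert y CB) \<le> real (card V) * (1 + l) ^ (w + 1)"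
      using D(15) assms(3) by simp
    show "proper E (f(y \<mapsto> c))" using D(1) assms(4) by (rule proper_upd)
    show "dom (f(y \<mapsto> c)) \<subseteq> V" using D(2) assms(3) by auto
    show "insert y C \<subseteq> dom (f(y \<mapsto> c))" using D(3) by auto
    show "insert y C = CA \<union> insert y CB" using D(4) by auto
    show "CA \<inter> insert y CB = {}" using D(4,5) assms(3) by auto
    show "Q \<subseteq> V" by (rule D(6))
    show "card (insert y C) = j * Ep + Suc e" using D(10,17) assms(3) by simp
    show "w + card (Q - insert y C) \<le> z * (j + 1)" using D(11) 1 by linarith
    show "Suc e \<le> Ep" using assms(2) by simp
    show "card ((f(y \<mapsto> c)) ` CA - Some ` {1..K}) \<le> w" using D(13) 2 by simp
  qed simp
qed

text \<open>
  After Alice's best move, no reply of Bob can raise the potential above its old value,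
  since his vertex was available to her and the gains only shrink.
\<close>

lemma core_alice:
  assumes "core True f C CA CB Q e j w" "e < Ep" "C \<noteq> V"
  shows "\<exists>y\<in>V - C. \<exists>c w'. can_take E k f y c \<and>
    core False (f(y \<mapsto> c)) (insert y C) (insert y CA) CB Q (Suc e) j w'"
proof -
  note D = coreD[OF assms(1)]
  have finQ: "finite Q" using D(6) finV finite_subset by blast
  have seen: "\<forall>v\<in>V - insert y C. (v \<in> Q \<longrightarrow> A \<le> card ({1..k} - seen (f(y \<mapsto> c)) v) + Suc e) \<and>
                (v \<notin> Q \<longrightarrow> \<tau> \<le> card ({1..K} - seen (f(y \<mapsto> c)) v) + Suc e)" for y c
  proof -
    have "card ({1..m} - seen f v) + e \<le> card ({1..m} - seen (f(y \<mapsto> c)) v) + Suc e" for m v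
      using card_seen_upd[of m f v y c] by simp
    then show ?thesis using D(7,8) by (blast intro: order_trans)
  qed
  have img: "(f(y \<mapsto> c)) ` insert y CA = insert (Some c) (f ` CA)" if "y \<notin> C" for y c
  proof -
    have "(f(y \<mapsto> c)) ` CA = f ` CA" using D(4) that by (intro image_cong) auto
    then show ?thesis by auto
  qed
  show ?thesis
  proof (cases "Q \<subseteq> C")
    case False
    then obtain y where y: "y \<in> Q" "y \<notin> C" by auto
    then have yV: "y \<in> V - C" using D(6) by auto
    obtain c where c: "can_take E k f y c"
      using ex_can_take[OF core_available(1)[OF assms(1) yV]] by auto
    have cQ: "Suc (card (Q - insert y C)) = card (Q - C)"
      using y finQ by (metis Diff_insert card_Suc_Diff1 finite_Diff DiffI)
    have pA: "potential (insert y CA) CB \<le> potential CA CB"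
      using potential_insert_A[of y CA CB] gain_nonneg[of CA CB y] D y l by simp
    have "core False (f(y \<mapsto> c)) (insert y C) (insert y CA) CB Q (Suc e) j (Suc w)"
      unfolding core_def
    proof (intro conjI)
      show "Q \<subseteq> insert y C \<or> 2 * card (Q - insert y C) + Suc e \<le> 2 * z + (if False then 1 else 0)"
        using D(9) False cQ by auto
      show "card ((f(y \<mapsto> c)) ` insert y CA - Some ` {1..K}) \<le> Suc w"
      proof -
        have "card (insert (Some c) (f ` CA) - Some ` {1..K}) \<le> card (insert (Some c) (f ` CA - Some ` {1..K}))"
          using D(18) by (intro card_mono) auto
        also have "\<dots> \<le> Suc (card (f ` CA - Some ` {1..K}))" using D(18) by (simp add: card_insert_if)
        finally show ?thesis using img[OF y(2)] D(13) by simp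
      qed
      \<comment> \<open>A forced move on a low vertex forgoes the choice by gain. Bob's reply then
        raises the potential by at most the factor \<open>1 + l\<close>, because no gain exceeds the
        potential; increasing \<open>w\<close> pays for this factor.\<close>
      have *: "(1 + l) * potential CA CB \<le> real (card V) * (1 + l) ^ (Suc w + 1)"
        using mult_left_mono[OF D(14), of "1 + l"] l by (simp add: mult_ac)
      have "potential CA CB \<le> (1 + l) * potential CA CB"
        using l gain_nonneg[of CA CB y] gain_le_potential[of CA CB y] by (simp add: algebra_simps)
      with * pA show "potential (insert y CA) CB \<le> real (card V) * (1 + l) ^ (Suc w + 1)" by linarith
      show "\<not> False \<longrightarrow> (\<forall>x\<in>V - insert y C. potential (insert y CA) (insert x CB) \<le> real (card V) * (1 + l) ^ (Suc w + 1))"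
      proof (intro impI ballI)
        fix x assume x: "x \<in> V - insert y C"
        have "potential (insert y CA) (insert x CB) = potential (insert y CA) CB + l * gain (insert y CA) CB x"
          using x D by (intro potential_insert_B) auto
        also have "\<dots> \<le> (1 + l) * potential (insert y CA) CB"
          using gain_le_potential[of "insert y CA" CB x] l by (simp add: algebra_simps)
        also have "\<dots> \<le> (1 + l) * potential CA CB" using pA l by simp
        finally show "potential (insert y CA) (insert x CB) \<le> real (card V) * (1 + l) ^ (Suc w + 1)"
          using * by linarith
      qed
      show "proper E (f(y \<mapsto> c))" using D(1) c by (rule proper_upd)
      show "dom (f(y \<mapsto> c)) \<subseteq> V" using D(2) yV by auto
      show "insert y C \<subseteq> dom (f(y \<mapsto> c))" using D(3) by auto
      show "insert y C = insert y CA \<union> CB" using D(4) by auto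
      show "insert y CA \<inter> CB = {}" using D(4,5) yV by auto
      show "Q \<subseteq> V" by (rule D(6))
      show "\<forall>v\<in>V - insert y C. (v \<in> Q \<longrightarrow> A \<le> card ({1..k} - seen (f(y \<mapsto> c)) v) + Suc e) \<and>
                (v \<notin> Q \<longrightarrow> \<tau> \<le> card ({1..K} - seen (f(y \<mapsto> c)) v) + Suc e)" by (rule seen)
      show "card (insert y C) = j * Ep + Suc e" using D(10,17) yV by simp
      show "Suc e \<le> Ep" using assms(2) by simp
      show "Suc w + card (Q - insert y C) \<le> z * (j + 1)" using D(11) cQ by simp
    qed
    then show ?thesis using c yV by blast
  next
    case True
    have ne: "V - C \<noteq> {}" "finite (V - C)" using assms(3) D(16) finV by auto
    have "Max (gain CA CB ` (V - C)) \<in> gain CA CB ` (V - C)"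
      using ne by (intro Max_in) auto
    then obtain y where Max: "Max (gain CA CB ` (V - C)) = gain CA CB y" and y: "y \<in> V - C"
      by (rule imageE)
    have ymax: "gain CA CB x \<le> gain CA CB y" if "x \<in> V - C" for x
      unfolding Max[symmetric] using ne that by (intro Max_ge) auto
    have yQ: "y \<notin> Q" using True y by auto
    obtain c where c: "can_take E k f y c" "c \<in> {1..K}"
      using ex_can_take[OF core_available(2)[OF assms(1) y yQ] K(1)] by auto
    have pA: "potential (insert y CA) CB = potential CA CB - l * gain CA CB y"
      using y D by (intro potential_insert_A) auto
    have "core False (f(y \<mapsto> c)) (insert y C) (insert y CA) CB Q (Suc e) j w"
      unfolding core_def
    proof (intro conjI)
      show "card ((f(y \<mapsto> c)) ` insert y CA - Some ` {1..K}) \<le> w"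
        using img[of y c] y c D(13) by simp
      show "potential (insert y CA) CB \<le> real (card V) * (1 + l) ^ (w + 1)"
        using pA D(14) gain_nonneg[of CA CB y] l by (smt (verit) mult_nonneg_nonneg)
      show "\<not> False \<longrightarrow> (\<forall>x\<in>V - insert y C. potential (insert y CA) (insert x CB) \<le> real (card V) * (1 + l) ^ (w + 1))"
      proof (intro impI ballI)
        fix x assume x: "x \<in> V - insert y C"
        have "potential (insert y CA) (insert x CB) = potential (insert y CA) CB + l * gain (insert y CA) CB x"
          using x D by (intro potential_insert_B) auto
        moreover have "gain (insert y CA) CB x \<le> gain CA CB x"
          using y D by (intro gain_insert_A) auto
        moreover have "gain CA CB x \<le> gain CA CB y" using x ymax by auto
        ultimately have "potential (insert y CA) (insert x CB) \<le> potential CA CB"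
          using pA l mult_left_mono[of "gain (insert y CA) CB x" "gain CA CB y" l] by linarith
        then show "potential (insert y CA) (insert x CB) \<le> real (card V) * (1 + l) ^ (w + 1)"
          using D(14) by linarith
      qed
      show "Q \<subseteq> insert y C \<or> 2 * card (Q - insert y C) + Suc e \<le> 2 * z + (if False then 1 else 0)"
        using True by auto
      have Q0: "Q - insert y C = {}" "Q - C = {}" using True by auto
      show "w + card (Q - insert y C) \<le> z * (j + 1)" using D(11) unfolding Q0 .
      show "proper E (f(y \<mapsto> c))" using D(1) c(1) by (rule proper_upd)
      show "dom (f(y \<mapsto> c)) \<subseteq> V" using D(2) y by auto
      show "insert y C \<subseteq> dom (f(y \<mapsto> c))" using D(3) by auto
      show "insert y C = insert y CA \<union> CB" using D(4) by auto
      show "insert y CA \<inter> CB = {}" using D(4,5) y by auto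
      show "Q \<subseteq> V" by (rule D(6))
      show "\<forall>v\<in>V - insert y C. (v \<in> Q \<longrightarrow> A \<le> card ({1..k} - seen (f(y \<mapsto> c)) v) + Suc e) \<and>
                (v \<notin> Q \<longrightarrow> \<tau> \<le> card ({1..K} - seen (f(y \<mapsto> c)) v) + Suc e)" by (rule seen)
      show "card (insert y C) = j * Ep + Suc e" using D(10,17) y by simp
      show "Suc e \<le> Ep" using assms(2) by simp
    qed
    then show ?thesis using c y by blast
  qed
qed

section \<open>Renewal at the end of an epoch and of a round\<close>

definition low :: "('a \<Rightarrow> nat option) \<Rightarrow> 'a set" where
  "low f = {v \<in> V. card ({1..K} - seen f v) < \<tau>}"

lemma card_low: "dom f \<subseteq> V \<Longrightarrow> card (low f) \<le> z"
  unfolding low_def seen_def by (rule few_low)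

lemma finite_low: "finite (low f)"
  using finV by (simp add: low_def)

text \<open>As \<open>2 * z + 1 < Ep\<close>, the set \<open>Q\<close> is exhausted by now. So each
  available vertex began the epoch with \<open>\<tau>\<close> missing palette colours and keeps at
  least \<open>\<tau> - Ep\<close>, hence \<open>A\<close>, of them, even if it has become
  low.\<close>

lemma core_new_epoch:
  assumes "core a f C CA CB Q Ep j w"
  shows "core a f C CA CB (low f - C) 0 (Suc j) w"
proof -
  note D = coreD[OF assms]
  have QC: "Q \<subseteq> C" using D(9) Ep by (auto split: if_splits)
  have "card (low f - C) \<le> card (low f)" by (intro card_mono finite_low) auto
  then have low: "card (low f - C) \<le> z" using card_low[OF D(2)] by simp
  have Q0: "Q - C = {}" using QC by auto
  have idem: "low f - C - C = low f - C" by auto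
  show ?thesis
    unfolding core_def
  proof (intro conjI)
    show "\<forall>v\<in>V - C. (v \<in> low f - C \<longrightarrow> A \<le> card ({1..k} - seen f v) + 0) \<and>
                (v \<notin> low f - C \<longrightarrow> \<tau> \<le> card ({1..K} - seen f v) + 0)"
    proof (intro ballI conjI impI)
      fix v assume v: "v \<in> V - C"
      then have "v \<notin> Q" using QC by auto
      then show "A \<le> card ({1..k} - seen f v) + 0"
        using D(8)[OF v] \<tau> card_seen_palette[of f v] by linarith
      assume "v \<notin> low f - C"
      then show "\<tau> \<le> card ({1..K} - seen f v) + 0" using v by (auto simp: low_def)
    qed
    show "w + card (low f - C - C) \<le> z * (Suc j + 1)" using low D(11) unfolding idem Q0 by simp
    show "low f - C \<subseteq> C \<or> 2 * card (low f - C - C) + 0 \<le> 2 * z + (if a then 1 else 0)"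
      using low idem by simp
    show "card C = Suc j * Ep + 0" using D(10) by simp
    show "low f - C \<subseteq> V" by (auto simp: low_def)
    show "\<not> a \<longrightarrow> (\<forall>x\<in>V - C. potential CA (insert x CB) \<le> real (card V) * (1 + l) ^ (w + 1))"
      using D(15) by blast
  qed (use D(1-5,13,14) in \<open>simp_all\<close>)
qed

lemma potential_empty: "potential {} {} = real (card V)"
  by (simp add: potential_def weight_def)

lemma core_fresh:
  assumes "proper E f" "dom f \<subseteq> V" "\<And>v. v \<in> V \<Longrightarrow> A \<le> card ({1..k} - seen f v)"
  shows "core a f {} {} {} (low f) 0 0 0"
  unfolding core_def
proof (intro conjI)
  \<comment> \<open>If Bob opens the round, no move of Alice precedes his first one; the 1 in the
    exponent \<open>w + 1\<close> is the allowance for it.\<close>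
  show "\<not> a \<longrightarrow> (\<forall>x\<in>V - {}. potential {} (insert x {}) \<le> real (card V) * (1 + l) ^ (0 + 1))"
  proof (intro impI ballI)
    fix x assume "x \<in> V - {}"
    have "potential {} (insert x {}) = potential {} {} + l * gain {} {} x"
      by (rule potential_insert_B) auto
    also have "\<dots> \<le> (1 + l) * potential {} {}"
      using gain_le_potential[of "{}" "{}" x] l by (simp add: algebra_simps)
    finally show "potential {} (insert x {}) \<le> real (card V) * (1 + l) ^ (0 + 1)"
      by (simp add: potential_empty mult.commute)
  qed
  show "potential {} {} \<le> real (card V) * (1 + l) ^ (0 + 1)"
    using l by (simp add: potential_empty algebra_simps)
qed (use assms card_low[OF assms(2)] Ep in \<open>auto simp: low_def not_less\<close>)

text \<open>A colour seen at \<open>v\<close> is in the palette, or among at most \<open>w\<close>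
  other colours of Alice, or on a neighbour chosen by Bob. The weight of \<open>v\<close> is one
  summand of the potential, so \<open>balance\<close> bounds the last kind. The opener
  \<open>b\<close> of the next round is left arbitrary because it changes with the parity of
  \<open>card V\<close>.\<close>

lemma core_new_round:
  assumes "core a f V CA CB Q e j w"
  shows "core b f {} {} {} (low f) 0 0 0"
proof (rule core_fresh)
  note D = coreD[OF assms]
  fix v assume v: "v \<in> V"
  have fin: "finite (f ` CA - Some ` {1..K})" using D(18) by auto
  have "Some ` seen f v \<subseteq> (f ` CA - Some ` {1..K}) \<union> (Some ` {1..K} \<union> f ` (CB \<inter> nbhd E v))"
  proof
    fix u assume "u \<in> Some ` seen f v"
    then obtain x where x: "x \<in> nbhd E v" "u = f x" by (auto simp: seen_def)
    then have "x \<in> CA \<union> CB" using D(4) nbhd_subset[of v] by blast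
    then show "u \<in> (f ` CA - Some ` {1..K}) \<union> (Some ` {1..K} \<union> f ` (CB \<inter> nbhd E v))"
      using x by blast
  qed
  then have "card (Some ` seen f v) \<le> card ((f ` CA - Some ` {1..K}) \<union> (Some ` {1..K} \<union> f ` (CB \<inter> nbhd E v)))"
    using D(19) fin by (intro card_mono) auto
  also have "\<dots> \<le> card (f ` CA - Some ` {1..K}) + (card (Some ` {1..K}) + card (f ` (CB \<inter> nbhd E v)))"
    by (rule order_trans[OF card_Un_le add_left_mono[OF card_Un_le]])
  also have "\<dots> \<le> w + (K + card (CB \<inter> nbhd E v))"
    using D(13,19) card_image_le[of "CB \<inter> nbhd E v" f] by (simp add: card_image add_mono)
  finally have s: "card (seen f v) \<le> w + (K + card (CB \<inter> nbhd E v))"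
    by (simp add: card_image)
  have "card (CA \<inter> nbhd E v) + card (CB \<inter> nbhd E v) = card ((CA \<inter> nbhd E v) \<union> (CB \<inter> nbhd E v))"
    using D(5,18,19) by (subst card_Un_disjoint) auto
  also have "(CA \<inter> nbhd E v) \<union> (CB \<inter> nbhd E v) = nbhd E v"
    using D(4) nbhd_subset[of v] by blast
  finally have ab: "card (CA \<inter> nbhd E v) + card (CB \<inter> nbhd E v) = card (nbhd E v)" .
  \<comment> \<open>At most \<open>card V div Ep\<close> epochs of a round are complete; each of
    them and the current one cost Alice at most \<open>z\<close> forced moves.\<close>
  have "j * Ep \<le> card V" using D(10) by simp
  then have "j \<le> card V div Ep" using Ep by (simp add: less_eq_div_iff_mult_less_eq)
  then have "z * (j + 1) \<le> z * (card V div Ep + 1)" by (intro mult_left_mono) auto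
  then have w: "w \<le> z * (card V div Ep + 1)" using D(11) by linarith
  have "weight CA CB v \<le> potential CA CB"
    unfolding potential_def using v finV weight_pos by (intro member_le_sum) (auto intro: less_imp_le)
  then have "(1 + l) ^ card (CB \<inter> nbhd E v) * (1 - l) ^ card (CA \<inter> nbhd E v) \<le> real (card V) * (1 + l) ^ (w + 1)"
    using D(14) by (simp add: weight_def)
  from balance[OF v ab w this] s have "card (seen f v) + A \<le> k" by linarith
  moreover have "card {1..k} - card (seen f v) \<le> card ({1..k} - seen f v)"
    by (rule diff_card_le_card_Diff[OF finite_seen])
  ultimately show "A \<le> card ({1..k} - seen f v)" by simp
qed (rule coreD[OF assms])+

section \<open>Alice's strategy on histories\<close>

definition state :: "bool \<Rightarrow> ('a \<Rightarrow> nat option) \<Rightarrow> 'a set \<Rightarrow> bool" where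
  "state a f C \<longleftrightarrow> C \<noteq> V \<and> (\<exists>CA CB Q e j w. core a f C CA CB Q e j w \<and> e < Ep)"

lemma stateI: "core a f C CA CB Q e j w \<Longrightarrow> e < Ep \<Longrightarrow> C \<noteq> V \<Longrightarrow> state a f C"
  unfolding state_def by blast

text \<open>Normalisation after a move: a finished round or epoch is replaced at once by a new one,
  so that a \<open>state\<close> always leaves an available vertex and room for a move in the
  epoch.\<close>

lemma state_if_core:
  assumes "core a f C CA CB Q e j w"
  shows "state a f (if C = V then {} else C)"
proof (cases "C = V")
  case True
  have "core a f {} {} {} (low f) 0 0 0" using assms True core_new_round by blast
  then show ?thesis using True V Ep stateI by fastforce
next
  case False
  show ?thesis
  proof (cases "e < Ep")
    case True
    then show ?thesis using False assms by (simp add: stateI)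
  next
    case e: False
    then have "e = Ep" using coreD(12)[OF assms] by simp
    then have "core a f C CA CB (low f - C) 0 (Suc j) w" using assms core_new_epoch by blast
    then show ?thesis using False Ep by (simp add: stateI)
  qed
qed

lemma state_empty: "state True Map.empty {}"
proof -
  have "core True Map.empty {} {} {} (low Map.empty) 0 0 0"
    using K A \<tau> by (intro core_fresh) (auto simp: proper_def seen_def)
  then show ?thesis using V Ep by (simp add: stateI)
qed

lemma alice_wins: "\<exists>\<sigma>. winning_strategy V E k \<sigma>"
proof (rule winning_strategyI[where Inv = "\<lambda>h. state (even (length h)) (colouring h) (chosen_this_round V h) \<and>
    card (chosen_this_round V h) = length h mod card V"])
  have cV: "card V > 0" using V finV by (simp add: card_gt_0_iff)
  have avail: "available V h v \<longleftrightarrow> v \<in> V - chosen_this_round V h" for h v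
    by (auto simp: available_def)
  \<comment> \<open>Histories reset the round when their length is a multiple of
    \<open>card V\<close>, states when all vertices have been chosen. The cardinality clause of the
    invariant makes the two agree.\<close>
  have next_round: "chosen_this_round V (h @ [(y, c)]) =
      (if insert y (chosen_this_round V h) = V then {} else insert y (chosen_this_round V h))"
    "card (chosen_this_round V (h @ [(y, c)])) = length (h @ [(y, c)]) mod card V"
    if st: "state b f (chosen_this_round V h)" and "card (chosen_this_round V h) = length h mod card V"
      and y: "y \<in> V - chosen_this_round V h" for b f h y c
  proof -
    obtain CA CB Q e j w where "core b f (chosen_this_round V h) CA CB Q e j w"
      using st unfolding state_def by blast
    then have sub: "chosen_this_round V h \<subseteq> V" "finite (chosen_this_round V h)"
      by (rule coreD(16), rule coreD(17))
    then have card: "card (insert y (chosen_this_round V h)) = Suc (length h mod card V)"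
      using that by simp
    have "insert y (chosen_this_round V h) \<subseteq> V" using sub y by auto
    then have "insert y (chosen_this_round V h) = V \<longleftrightarrow> card (insert y (chosen_this_round V h)) = card V"
      using card_subset_eq[OF finV] by metis
    also have "\<dots> \<longleftrightarrow> Suc (length h) mod card V = 0"
      using card cV by (simp add: mod_Suc)
    finally have iff: "insert y (chosen_this_round V h) = V \<longleftrightarrow> Suc (length h) mod card V = 0" .
    then show "chosen_this_round V (h @ [(y, c)]) =
      (if insert y (chosen_this_round V h) = V then {} else insert y (chosen_this_round V h))"
      by (simp add: chosen_snoc[OF cV])
    show "card (chosen_this_round V (h @ [(y, c)])) = length (h @ [(y, c)]) mod card V"
      using card by (auto simp: chosen_snoc[OF cV] mod_Suc split: if_splits)
  qed
  let ?Inv = "\<lambda>h. state (even (length h)) (colouring h) (chosen_this_round V h) \<and>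
    card (chosen_this_round V h) = length h mod card V"
  show "?Inv []" by (simp add: state_empty)
  fix h assume h: "?Inv h"
  then obtain CA CB Q e j w where core: "core (even (length h)) (colouring h) (chosen_this_round V h) CA CB Q e j w"
    and e: "e < Ep" and CV: "chosen_this_round V h \<noteq> V" unfolding state_def by blast
  note legal = legal_colour_iff[OF coreD(1)[OF core]]
  have extend: "?Inv (h @ [(y, c)])"
    if "y \<in> V - chosen_this_round V h"
      "core (odd (length h)) ((colouring h)(y \<mapsto> c)) (insert y (chosen_this_round V h)) CA' CB' Q' e' j' w'"
    for y c CA' CB' Q' e' j' w'
    using state_if_core[OF that(2)] next_round[OF conjunct1[OF h] conjunct2[OF h] that(1)]
    by (simp add: colouring_snoc)
  {
    assume even: "even (length h)"
    with core_alice[OF _ e CV] core obtain y c w' where y: "y \<in> V - chosen_this_round V h"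
      "can_take E k (colouring h) y c"
      "core False ((colouring h)(y \<mapsto> c)) (insert y (chosen_this_round V h)) (insert y CA) CB Q (Suc e) j w'"
      by (metis (full_types))
    then have "legal_move V E k h (y, c)" by (simp add: legal_move_def avail legal)
    moreover have "?Inv (h @ [(y, c)])" using extend[OF y(1)] y(3) even by simp
    ultimately show "\<exists>m. legal_move V E k h m \<and> ?Inv (h @ [m])" by blast
  next
    fix v assume "odd (length h)"
    show "\<not> stuck V E k h v"
      using ex_can_take[OF core_available(1)[OF core]] by (auto simp: stuck_def avail legal)
  next
    fix m assume odd: "odd (length h)" and m: "legal_move V E k h m"
    obtain y c where [simp]: "m = (y, c)" by (cases m)
    have y: "y \<in> V - chosen_this_round V h" "can_take E k (colouring h) y c"
      using m by (auto simp: legal_move_def avail legal)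
    have "core True ((colouring h)(y \<mapsto> c)) (insert y (chosen_this_round V h)) CA (insert y CB) Q (Suc e) j w"
      using core odd e y by (intro core_bob) auto
    then show "?Inv (h @ [m])" using extend[OF y(1)] odd by simp
  }
qed

end

section \<open>Bob wins with too few colours\<close>

text \<open>
  The numbers \<open>16 * z + 5\<close> and \<open>16 * z + 7\<close> come from \<open>\<Psi> = 8 * z + 1\<close>, the initial value of
  Bob's potential: a pair is flagged when its reserve is at most \<open>2 * \<Psi> + 3\<close>.
\<close>

locale lower_graph = fin_graph V E for V :: "'a set" and E +
  fixes k z r :: nat
  assumes few_flagged: "\<And>R M. R \<subseteq> V \<Longrightarrow> r \<le> card R \<Longrightarrow> disjoint M \<Longrightarrow>
      (\<forall>T\<in>M. \<exists>w\<in>V. \<exists>w'\<in>V. T = {w, w'} \<and> card (R - nbhd E w - nbhd E w' - {w, w'}) \<le> 16 * z + 5) \<Longrightarrow>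
      card M < z"
    and degree: "\<And>u. u \<in> V \<Longrightarrow> 2 * k + 16 * z + 4 + r \<le> card (nbhd E u)"
    and priv: "\<And>u w w'. u \<in> V \<Longrightarrow> w \<in> V - {u} \<Longrightarrow> w' \<in> V - {u} \<Longrightarrow>
      16 * z + 7 \<le> card (nbhd E u - nbhd E w - nbhd E w' - {w, w'})"
    and r: "0 < r"

locale lower_game = lower_graph V E k z r for V :: "'a set" and E k z r +
  fixes v :: 'a and c0 :: nat
  assumes v: "v \<in> V"
begin

text \<open>
  A pending colour is used, but neither on a neighbour of \<open>v\<close> nor on \<open>v\<close>; \<open>pend\<close> are the vertices
  bearing pending colours, and \<open>live\<close> are those that bear one or may still receive one. Bob can
  place a pending colour in \<open>nbhd E v\<close> if it is borne by \<open>w\<close> and \<open>w'\<close> only and the reserve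
  \<open>res f w w'\<close> is nonempty.
\<close>

definition base :: "('a \<Rightarrow> nat option) \<Rightarrow> bool" where
  "base f \<longleftrightarrow> proper E f \<and> dom f \<subseteq> V \<and> ran f \<subseteq> {1..k} \<and> f v = Some c0"

definition cols :: "('a \<Rightarrow> nat option) \<Rightarrow> nat set" where
  "cols f = {c. \<exists>x\<in>nbhd E v. f x = Some c}"

definition free :: "('a \<Rightarrow> nat option) \<Rightarrow> 'a set" where
  "free f = nbhd E v - dom f"

definition pend :: "('a \<Rightarrow> nat option) \<Rightarrow> 'a set" where
  "pend f = {w. \<exists>c. f w = Some c \<and> c \<notin> cols f \<and> c \<noteq> c0}"

definition pcols :: "('a \<Rightarrow> nat option) \<Rightarrow> nat set" where
  "pcols f = {c \<in> ran f. c \<notin> cols f \<and> c \<noteq> c0}"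

definition unused :: "('a \<Rightarrow> nat option) \<Rightarrow> nat set" where
  "unused f = {1..k} - ran f"

definition live :: "('a \<Rightarrow> nat option) \<Rightarrow> 'a set" where
  "live f = (V - dom f) \<union> pend f"

definition res :: "('a \<Rightarrow> nat option) \<Rightarrow> 'a \<Rightarrow> 'a \<Rightarrow> 'a set" where
  "res f w w' = free f - nbhd E w - nbhd E w' - {w, w'}"

text \<open>\<open>c0\<close> itself may be missing around \<open>v\<close>: it is the colour of
  \<open>v\<close>, which the second round forbids \<open>v\<close> to keep.\<close>

definition won :: "('a \<Rightarrow> nat option) \<Rightarrow> bool" where
  "won f \<longleftrightarrow> {1..k} \<subseteq> insert c0 (cols f)"

text \<open>
  Weights chosen such that every round in which a vertex of \<open>Q\<close> is live decreases \<open>Psi\<close>: handling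
  an uncoloured vertex of \<open>Q\<close> may create a pending colour, while Alice creates another one.
\<close>

definition Psi :: "('a \<Rightarrow> nat option) \<Rightarrow> 'a set \<Rightarrow> nat" where
  "Psi f Q = card (pcols f) + 4 * card (Q - dom f) + card (Q \<inter> pend f) + (if unused f = {} then 0 else 1)"

section \<open>Effect of a single move on pending colours, reserves and \<open>Psi\<close>\<close>

lemma baseD:
  assumes "base f"
  shows "proper E f" "dom f \<subseteq> V" "ran f \<subseteq> {1..k}" "f v = Some c0" "finite (dom f)" "finite (ran f)"
    "finite (pcols f)" "finite (pend f)" "pend f \<subseteq> dom f"
proof -
  show *: "proper E f" "dom f \<subseteq> V" "ran f \<subseteq> {1..k}" "f v = Some c0"
    using assms by (auto simp: base_def)
  show **: "finite (dom f)" "finite (ran f)"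
    using * finV finite_subset[of _ "{1..k}"] by (auto intro: finite_subset)
  show "pend f \<subseteq> dom f" by (auto simp: pend_def)
  then show "finite (pend f)" using ** finite_subset by blast
  show "finite (pcols f)" using ** by (simp add: pcols_def)
qed

lemma cols_subset: "base f \<Longrightarrow> cols f \<subseteq> {1..k}"
  using baseD(3)[of f] by (auto simp: cols_def ran_def)

lemma finite_cols: "base f \<Longrightarrow> finite (cols f)"
  using cols_subset finite_subset by blast

lemma finite_free: "finite (free f)"
  by (simp add: free_def finite_nbhd)

lemma pcols_iff: "c \<in> pcols f \<longleftrightarrow> (\<exists>w\<in>pend f. f w = Some c)"
  by (auto simp: pcols_def pend_def ran_def)

context
  fixes f y c
  assumes f: "base f" and y: "y \<in> V - dom f" and c: "can_take E k f y c"
begin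

lemma base_upd: "base (f(y \<mapsto> c))"
proof -
  have "y \<noteq> v" using y baseD(4)[OF f] by auto
  moreover have "ran (f(y \<mapsto> c)) = insert c (ran f)" using y by (intro ran_map_upd) auto
  moreover have "c \<in> {1..k}" using c by (simp add: can_take_def)
  ultimately show ?thesis
    using y f proper_upd[OF baseD(1)[OF f] c] by (auto simp: base_def)
qed

lemma ran_upd: "ran (f(y \<mapsto> c)) = insert c (ran f)"
  using y by (intro ran_map_upd) auto

lemma unused_upd: "unused (f(y \<mapsto> c)) = unused f - {c}"
  unfolding unused_def ran_upd by auto

lemma free_upd: "free (f(y \<mapsto> c)) = free f - {y}"
  by (auto simp: free_def)

lemma cols_upd: "cols (f(y \<mapsto> c)) = (if y \<in> nbhd E v then insert c (cols f) else cols f)"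
proof (intro set_eqI)
  fix c'
  have "c' \<in> cols (f(y \<mapsto> c)) \<longleftrightarrow> (\<exists>x\<in>nbhd E v - {y}. f x = Some c') \<or> (y \<in> nbhd E v \<and> c' = c)"
    unfolding cols_def by auto
  also have "(\<exists>x\<in>nbhd E v - {y}. f x = Some c') \<longleftrightarrow> c' \<in> cols f"
    using y unfolding cols_def by force
  finally show "c' \<in> cols (f(y \<mapsto> c)) \<longleftrightarrow> c' \<in> (if y \<in> nbhd E v then insert c (cols f) else cols f)"
    by (cases "y \<in> nbhd E v") (simp_all del: fun_upd_apply add: disj_commute)
qed

lemma cols_mono: "cols f \<subseteq> cols (f(y \<mapsto> c))"
  by (auto simp: cols_upd)

lemma pend_upd_subset: "pend (f(y \<mapsto> c)) \<subseteq> insert y (pend f)"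
  using cols_mono by (auto simp: pend_def)

text \<open>Vertices never become live again, so conditions on reserves need only be carried along
  for pairs that are already live.\<close>

lemma live_upd: "live (f(y \<mapsto> c)) \<subseteq> live f"
  using pend_upd_subset y by (auto simp: live_def)

lemma res_upd: "card (res f w w') \<le> card (res (f(y \<mapsto> c)) w w') + 1"
proof -
  have "res f w w' \<subseteq> insert y (res (f(y \<mapsto> c)) w w')" by (auto simp: res_def free_upd)
  then have "card (res f w w') \<le> card (insert y (res (f(y \<mapsto> c)) w w'))"
    by (intro card_mono) (auto simp: res_def finite_free)
  also have "\<dots> \<le> card (res (f(y \<mapsto> c)) w w') + 1"
    by (simp add: card_insert_if res_def finite_free)
  finally show ?thesis .
qed

lemma res_upd_le: "card (res (f(y \<mapsto> c)) w w') \<le> card (res f w w')"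
  by (intro card_mono) (auto simp: res_def free_upd finite_free)

lemma card_dom_upd: "card (dom (f(y \<mapsto> c))) = card (dom f) + 1"
  using y baseD(5)[OF f] by simp

lemma Q_upd: "Q - dom (f(y \<mapsto> c)) = (Q - dom f) - {y}"
  by auto

lemma card_Q_upd: "Q \<subseteq> V \<Longrightarrow> card (Q - dom (f(y \<mapsto> c))) + (if y \<in> Q then 1 else 0) = card (Q - dom f)"
proof -
  assume "Q \<subseteq> V"
  then have fin: "finite (Q - dom f)" using finV finite_subset by blast
  show ?thesis
  proof (cases "y \<in> Q")
    case True
    then have "y \<in> Q - dom f" using y by auto
    then show ?thesis using True fin card_Suc_Diff1[OF fin] unfolding Q_upd by simp
  next
    case False
    then have "(Q - dom f) - {y} = Q - dom f" by auto
    then show ?thesis using False unfolding Q_upd by simp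
  qed
qed

lemma unused_term_upd: "(if unused (f(y \<mapsto> c)) = {} then 0 else 1) \<le> (if unused f = {} then 0 else 1 :: nat)"
  by (auto simp: unused_upd)

lemma y_not_pend: "y \<notin> pend f"
  using y by (auto simp: pend_def)

text \<open>A colour that arrives next to \<open>v\<close> stops being pending, no matter which
  player put it there.\<close>

lemma nbr_pend:
  assumes "y \<in> nbhd E v"
  shows "pend (f(y \<mapsto> c)) = {w \<in> pend f. f w \<noteq> Some c}" "pcols (f(y \<mapsto> c)) = pcols f - {c}"
  using assms y unfolding pend_def pcols_def ran_upd cols_upd by (auto simp: dom_def)

lemma nbr_Psi:
  assumes "y \<in> nbhd E v" "Q \<subseteq> V"
  shows "Psi (f(y \<mapsto> c)) Q \<le> Psi f Q" "y \<in> Q \<Longrightarrow> Psi (f(y \<mapsto> c)) Q + 4 \<le> Psi f Q"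
    "c \<in> pcols f \<Longrightarrow> Psi (f(y \<mapsto> c)) Q + 1 \<le> Psi f Q"
    "w \<in> Q \<Longrightarrow> w \<in> pend f \<Longrightarrow> f w = Some c \<Longrightarrow> Psi (f(y \<mapsto> c)) Q + 2 \<le> Psi f Q"
proof -
  note D = baseD[OF f]
  have p: "card (pcols (f(y \<mapsto> c))) \<le> card (pcols f)" "c \<in> pcols f \<Longrightarrow> card (pcols (f(y \<mapsto> c))) + 1 = card (pcols f)"
    unfolding nbr_pend[OF assms(1)] using D(7) card_Suc_Diff1[of "pcols f" c] by (auto intro: card_mono)
  have q: "card (Q \<inter> pend (f(y \<mapsto> c))) \<le> card (Q \<inter> pend f)"
    unfolding nbr_pend[OF assms(1)] using D(8) by (intro card_mono) auto
  have q2: "card (Q \<inter> pend (f(y \<mapsto> c))) < card (Q \<inter> pend f)" if "w \<in> Q" "w \<in> pend f" "f w = Some c" for w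
    unfolding nbr_pend[OF assms(1)] using D(8) that by (intro psubset_card_mono) auto
  note u = card_Q_upd[OF assms(2)] unused_term_upd
  show "Psi (f(y \<mapsto> c)) Q \<le> Psi f Q" using p q u unfolding Psi_def by linarith
  show "Psi (f(y \<mapsto> c)) Q + 4 \<le> Psi f Q" if "y \<in> Q"
  proof -
    have "card (Q - dom (f(y \<mapsto> c))) + 1 = card (Q - dom f)" using u(1) that by simp
    then show ?thesis using p(1) q u(2) unfolding Psi_def by linarith
  qed
  show "Psi (f(y \<mapsto> c)) Q + 1 \<le> Psi f Q" if "c \<in> pcols f" using p(2)[OF that] q u unfolding Psi_def by linarith
  show "Psi (f(y \<mapsto> c)) Q + 2 \<le> Psi f Q" if w: "w \<in> Q" "w \<in> pend f" "f w = Some c"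
  proof -
    have "c \<in> pcols f" using w pcols_iff by blast
    then show ?thesis using p(2) q2[OF w] u unfolding Psi_def by linarith
  qed
qed

lemma old_upd:
  assumes "y \<notin> nbhd E v" "c \<in> insert c0 (cols f)" "Q \<subseteq> V"
  shows "pend (f(y \<mapsto> c)) = pend f" "Psi (f(y \<mapsto> c)) Q \<le> Psi f Q"
proof -
  show 1: "pend (f(y \<mapsto> c)) = pend f" using assms y by (auto simp: pend_def cols_upd)
  have 2: "pcols (f(y \<mapsto> c)) = pcols f" using assms unfolding pcols_def ran_upd cols_upd by auto
  show "Psi (f(y \<mapsto> c)) Q \<le> Psi f Q"
    using card_Q_upd[OF assms(3)] unused_term_upd unfolding Psi_def 1 2 by linarith
qed

lemma new_pend:
  assumes "y \<notin> nbhd E v" "c \<notin> insert c0 (cols f)"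
  shows "pend (f(y \<mapsto> c)) = insert y (pend f)" "pcols (f(y \<mapsto> c)) = insert c (pcols f)"
  using assms unfolding pend_def pcols_def ran_upd cols_upd by auto

lemma card_Q_insert_pend: "card (Q \<inter> insert y (pend f)) \<le> card (Q \<inter> pend f) + (if y \<in> Q then 1 else 0)"
  using baseD(8)[OF f] by (auto simp: card_insert_if)

lemma pending_Psi:
  assumes "y \<notin> nbhd E v" "c \<in> pcols f" "Q \<subseteq> V"
  shows "Psi (f(y \<mapsto> c)) Q \<le> Psi f Q"
proof -
  have "c \<notin> insert c0 (cols f)" "insert c (pcols f) = pcols f" using assms(2) by (auto simp: pcols_def)
  then have *: "pend (f(y \<mapsto> c)) = insert y (pend f)" "pcols (f(y \<mapsto> c)) = pcols f"
    using new_pend[OF assms(1)] by auto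
  show ?thesis
    using card_Q_upd[OF assms(3)] unused_term_upd card_Q_insert_pend[of Q] unfolding Psi_def * by linarith
qed

lemma fresh_Psi:
  assumes "y \<notin> nbhd E v" "c \<notin> ran f" "Q \<subseteq> V"
  shows "Psi (f(y \<mapsto> c)) Q \<le> Psi f Q + 1" "y \<in> Q \<Longrightarrow> Psi (f(y \<mapsto> c)) Q + 2 \<le> Psi f Q"
    "unused (f(y \<mapsto> c)) = {} \<Longrightarrow> Psi (f(y \<mapsto> c)) Q \<le> Psi f Q"
    "pend (f(y \<mapsto> c)) = insert y (pend f)" "pcols (f(y \<mapsto> c)) \<noteq> {}"
proof -
  have "c \<notin> insert c0 (cols f)" using assms(2) baseD(4)[OF f] by (auto simp: cols_def ran_def)
  note * = new_pend[OF assms(1) this]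
  have "c \<in> unused f" using assms(2) c by (simp add: unused_def can_take_def)
  then have un: "unused f \<noteq> {}" by auto
  have p: "card (insert c (pcols f)) \<le> card (pcols f) + 1"
    using baseD(7)[OF f] by (simp add: card_insert_if)
  note q = card_Q_upd[OF assms(3)] card_Q_insert_pend[of Q]
  show "Psi (f(y \<mapsto> c)) Q \<le> Psi f Q + 1"
    using p q unused_term_upd unfolding Psi_def * by (simp split: if_splits)
  show "Psi (f(y \<mapsto> c)) Q + 2 \<le> Psi f Q" if "y \<in> Q"
    using p q that unused_term_upd unfolding Psi_def * by (simp split: if_splits)
  show "Psi (f(y \<mapsto> c)) Q \<le> Psi f Q" if "unused (f(y \<mapsto> c)) = {}"
    using p q that un unfolding Psi_def * by (simp split: if_splits)
  show "pend (f(y \<mapsto> c)) = insert y (pend f)" "pcols (f(y \<mapsto> c)) \<noteq> {}" using * by auto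
qed

lemma inj_on_pend_upd: "S \<subseteq> pend f \<Longrightarrow> inj_on f S \<Longrightarrow> inj_on (f(y \<mapsto> c)) S"
  using y_not_pend by (auto simp: inj_on_def)

lemma inj_on_fresh: "c \<notin> ran f \<Longrightarrow> S \<subseteq> pend f \<Longrightarrow> inj_on f S \<Longrightarrow> inj_on (f(y \<mapsto> c)) (insert y S)"
  using y_not_pend by (auto simp: inj_on_def ran_def)

end

text \<open>
  The position after Alice's move: either pending colours are borne by single vertices, or she has
  just repeated one pending colour on \<open>a\<close> or \<open>a'\<close>, and then she has not created a new one.
\<close>

definition threat :: "('a \<Rightarrow> nat option) \<Rightarrow> 'a set \<Rightarrow> nat \<Rightarrow> bool" where
  "threat f Q t \<longleftrightarrow>
     (inj_on f (pend f) \<and> Psi f Q \<le> t + 1 \<and> (unused f = {} \<or> pcols f = {} \<longrightarrow> Psi f Q \<le> t)) \<or>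
     (\<exists>a\<in>pend f. \<exists>a'\<in>pend f. a \<noteq> a' \<and> f a = f a' \<and> inj_on f (pend f - {a}) \<and> Psi f Q \<le> t)"

text \<open>Only a brand-new colour outside the neighbourhood of \<open>v\<close> can raise
  \<open>Psi\<close>, and by at most 1. Moves next to \<open>v\<close> help Bob, colours that are
  \<open>c0\<close> or already next to \<open>v\<close> leave the pending vertices alone, and a
  repeated pending colour leads to the second alternative of \<open>threat\<close>.\<close>

lemma threat_if_alice_moves:
  assumes f: "base f" and y: "y \<in> V - dom f" and c: "can_take E k f y c"
    and inj: "inj_on f (pend f)" and Q: "Q \<subseteq> V"
  shows "threat (f(y \<mapsto> c)) Q (Psi f Q)"
proof (cases "y \<in> nbhd E v")
  case True
  have "inj_on (f(y \<mapsto> c)) (pend (f(y \<mapsto> c)))"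
    unfolding nbr_pend[OF f y c True]
    by (intro inj_on_pend_upd[OF f y c] inj_on_subset[OF inj]) auto
  then show ?thesis using nbr_Psi(1)[OF f y c True Q] by (simp add: threat_def)
next
  case nbr: False
  consider "c \<in> insert c0 (cols f)" | "c \<in> pcols f" | "c \<notin> ran f"
    by (auto simp: pcols_def)
  then show ?thesis
  proof cases
    case 1
    have "inj_on (f(y \<mapsto> c)) (pend (f(y \<mapsto> c)))"
      unfolding old_upd(1)[OF f y c nbr 1 Q] by (intro inj_on_pend_upd[OF f y c] inj) auto
    then show ?thesis using old_upd(2)[OF f y c nbr 1 Q] by (simp add: threat_def)
  next
    case 2
    then obtain w where w: "w \<in> pend f" "f w = Some c" using pcols_iff by blast
    have "c \<notin> insert c0 (cols f)" using 2 by (auto simp: pcols_def)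
    then have p: "pend (f(y \<mapsto> c)) = insert y (pend f)" using new_pend(1)[OF f y c nbr] by simp
    have "insert y (pend f) - {y} = pend f" using y_not_pend[OF f y c] by auto
    then have "inj_on (f(y \<mapsto> c)) (pend (f(y \<mapsto> c)) - {y})"
      unfolding p using inj_on_pend_upd[OF f y c _ inj] by simp
    moreover have "y \<noteq> w" using w y_not_pend[OF f y c] by auto
    ultimately show ?thesis
      unfolding threat_def using pending_Psi[OF f y c nbr 2 Q] w p
      by (intro disjI2 bexI[of _ y] bexI[of _ w]) auto
  next
    case 3
    note fr = fresh_Psi[OF f y c nbr 3 Q]
    have "inj_on (f(y \<mapsto> c)) (pend (f(y \<mapsto> c)))"
      unfolding fr(4) by (intro inj_on_fresh[OF f y c 3] inj) auto
    then show ?thesis using fr by (auto simp: threat_def)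
  qed
qed

section \<open>Bob's answer to a move of Alice\<close>

lemma reply:
  assumes f: "base f" and a: "a \<in> pend f" "a' \<in> pend f" "f a = Some c" "f a' = Some c"
    and only: "inj_on f (pend f - {a})" and res: "res f a a' \<noteq> {}" and aa': "a = a' \<Longrightarrow> inj_on f (pend f)"
    and Q: "Q \<subseteq> V"
  shows "\<exists>x\<in>V - dom f. can_take E k f x c \<and> inj_on (f(x \<mapsto> c)) (pend (f(x \<mapsto> c))) \<and>
    card (cols f) < card (cols (f(x \<mapsto> c))) \<and> Psi (f(x \<mapsto> c)) Q + 1 \<le> Psi f Q \<and>
    (a \<in> Q \<longrightarrow> Psi (f(x \<mapsto> c)) Q + 2 \<le> Psi f Q)"
proof -
  from res obtain x where x: "x \<in> free f" "x \<notin> nbhd E a" "x \<notin> nbhd E a'" by (auto simp: res_def)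
  then have xV: "x \<in> V - dom f" and xv: "x \<in> nbhd E v" using nbhd_subset by (auto simp: free_def)
  have c: "c \<notin> cols f" "c \<noteq> c0" "c \<in> pcols f" "c \<in> {1..k}"
    using a baseD(3)[OF f] by (auto simp: pend_def pcols_def ran_def)
  \<comment> \<open>A neighbour of \<open>x\<close> bearing \<open>c\<close> would be pending, hence
    \<open>a\<close> or \<open>a'\<close> by injectivity; but \<open>x\<close> lies in their reserve
    and is adjacent to neither. The case \<open>a = a'\<close> covers a colour borne once.\<close>
  have "f u \<noteq> Some c" if u: "u \<in> nbhd E x" for u
  proof
    assume fu: "f u = Some c"
    then have "u \<in> pend f" using c by (auto simp: pend_def)
    then have "u = a \<or> u = a'"
      using inj_onD[OF only, of u a'] inj_onD[OF aa', of u a] a fu by auto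
    then show False using u x nbhd_sym by blast
  qed
  then have ct: "can_take E k f x c" using c xV by (auto simp: can_take_def)
  have p: "pend (f(x \<mapsto> c)) \<subseteq> pend f - {a}" unfolding nbr_pend[OF f xV ct xv] using a by auto
  then have "inj_on (f(x \<mapsto> c)) (pend (f(x \<mapsto> c)))"
    using inj_on_subset[OF only p] by (intro inj_on_pend_upd[OF f xV ct]) auto
  moreover have "card (cols f) < card (cols (f(x \<mapsto> c)))"
    using c(1) finite_cols[OF f] xv by (simp add: cols_upd[OF f xV ct])
  moreover note nbr_Psi(3,4)[OF f xV ct xv Q]
  ultimately show ?thesis using a c xV ct by blast
qed

lemma bob_move:
  assumes f: "base f" and Q: "Q \<subseteq> V" and threat: "threat f Q t"
    and res: "\<And>w w'. w \<in> live f \<Longrightarrow> w' \<in> live f \<Longrightarrow> res f w w' \<noteq> {}"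
    and free: "free f \<noteq> {}" and nwon: "\<not> won f"
  shows "\<exists>x\<in>V - dom f. \<exists>c. can_take E k f x c \<and> inj_on (f(x \<mapsto> c)) (pend (f(x \<mapsto> c))) \<and>
    Psi (f(x \<mapsto> c)) Q \<le> t \<and> (Q \<inter> live f \<noteq> {} \<longrightarrow> Psi (f(x \<mapsto> c)) Q + 1 \<le> t) \<and>
    (card (cols f) < card (cols (f(x \<mapsto> c))) \<or> Psi (f(x \<mapsto> c)) Q + 1 \<le> t)"
proof -
  have pl: "pend f \<subseteq> live f" by (auto simp: live_def)
  from threat consider
    (single) "inj_on f (pend f)" "Psi f Q \<le> t + 1" "unused f = {} \<or> pcols f = {} \<longrightarrow> Psi f Q \<le> t"
    | (double) a a' where "a \<in> pend f" "a' \<in> pend f" "a \<noteq> a'" "f a = f a'" "inj_on f (pend f - {a})" "Psi f Q \<le> t"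
    unfolding threat_def by blast
  then show ?thesis
  proof cases
    case double
    then obtain c where c: "f a = Some c" "f a' = Some c" by (auto simp: pend_def)
    have "res f a a' \<noteq> {}" using res double pl by blast
    from reply[OF f double(1,2) c double(5) this _ Q] double(3)
    obtain x where "x \<in> V - dom f" "can_take E k f x c" "inj_on (f(x \<mapsto> c)) (pend (f(x \<mapsto> c)))"
      "card (cols f) < card (cols (f(x \<mapsto> c)))" "Psi (f(x \<mapsto> c)) Q + 1 \<le> Psi f Q" by blast
    then show ?thesis using double(6) by (intro bexI[of _ x] exI[of _ c]) auto
  next
    case single
    have reply1: "\<exists>x\<in>V - dom f. \<exists>c. can_take E k f x c \<and> inj_on (f(x \<mapsto> c)) (pend (f(x \<mapsto> c))) \<and>
      card (cols f) < card (cols (f(x \<mapsto> c))) \<and> Psi (f(x \<mapsto> c)) Q + 1 \<le> Psi f Q \<and>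
      (a \<in> Q \<longrightarrow> Psi (f(x \<mapsto> c)) Q + 2 \<le> Psi f Q)" if a: "a \<in> pend f" for a
    proof -
      obtain c where c: "f a = Some c" using a by (auto simp: pend_def)
      have "res f a a \<noteq> {}" using res a pl by blast
      from reply[OF f a a c c _ this _ Q] single(1) show ?thesis
        by (meson Diff_subset inj_on_subset)
    qed
    consider (q) a where "a \<in> Q" "a \<in> pend f"
      | (handle) "Q \<inter> pend f = {}" "Q - dom f \<noteq> {}" "unused f \<noteq> {}"
      | (pending) a where "Q \<inter> pend f = {}" "a \<in> pend f" "Q - dom f = {} \<or> unused f = {}"
      | (none) "pend f = {}" "Q - dom f = {} \<or> unused f = {}"
      by blast
    then show ?thesis
    proof cases
      case q
      from reply1[OF q(2)] obtain x c where "x \<in> V - dom f" "can_take E k f x c"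
        "inj_on (f(x \<mapsto> c)) (pend (f(x \<mapsto> c)))"
        "card (cols f) < card (cols (f(x \<mapsto> c)))" "Psi (f(x \<mapsto> c)) Q + 2 \<le> Psi f Q" using q(1) by blast
      then show ?thesis using single(2) by (intro bexI[of _ x] exI[of _ c]) auto
    next
      case handle
      then obtain y c where yc: "y \<in> Q" "y \<notin> dom f" "c \<in> unused f" by blast
      then have y: "y \<in> V - dom f" using Q by auto
      have cr: "c \<notin> ran f" "c \<in> {1..k}" using yc by (auto simp: unused_def)
      then have ct: "can_take E k f y c" by (auto simp: can_take_def ran_def)
      show ?thesis
      proof (cases "y \<in> nbhd E v")
        case True
        have "inj_on (f(y \<mapsto> c)) (pend (f(y \<mapsto> c)))"
          unfolding nbr_pend[OF f y ct True]
          by (intro inj_on_pend_upd[OF f y ct] inj_on_subset[OF single(1)]) auto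
        then show ?thesis using nbr_Psi(2)[OF f y ct True Q yc(1)] single(2) y ct
          by (intro bexI[of _ y] exI[of _ c]) auto
      next
        case False
        note fr = fresh_Psi[OF f y ct False cr(1) Q]
        have "inj_on (f(y \<mapsto> c)) (pend (f(y \<mapsto> c)))"
          unfolding fr(4) by (intro inj_on_fresh[OF f y ct cr(1)] single(1)) auto
        then show ?thesis using fr(2)[OF yc(1)] single(2) y ct
          by (intro bexI[of _ y] exI[of _ c]) auto
      qed
    next
      case pending
      from reply1[OF pending(2)] obtain x c where x: "x \<in> V - dom f" "can_take E k f x c"
        "inj_on (f(x \<mapsto> c)) (pend (f(x \<mapsto> c)))"
        "card (cols f) < card (cols (f(x \<mapsto> c)))" "Psi (f(x \<mapsto> c)) Q + 1 \<le> Psi f Q" by blast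
      have le: "Psi f Q \<le> t" if "Q \<inter> live f \<noteq> {}"
      proof -
        have "Q - dom f \<noteq> {}" using that pending(1) by (auto simp: live_def)
        then show ?thesis using pending(3) single(3) by blast
      qed
      have "Q \<inter> live f \<noteq> {} \<longrightarrow> Psi (f(x \<mapsto> c)) Q + 1 \<le> t"
        using le x(5) order_trans by blast
      moreover have "Psi (f(x \<mapsto> c)) Q \<le> t" using x(5) single(2) by linarith
      ultimately show ?thesis using x(1-4) by blast
    next
      case none
      then have pc: "pcols f = {}" using pcols_iff by blast
      \<comment> \<open>With nothing pending, a colour other than \<open>c0\<close> that is missing
        around \<open>v\<close> has not been used anywhere, so every free vertex accepts it.\<close>
      obtain c where c: "c \<in> {1..k}" "c \<noteq> c0" "c \<notin> cols f" using nwon unfolding won_def by blast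
      then have cr: "c \<notin> ran f" using pc by (auto simp: pcols_def)
      then have "unused f \<noteq> {}" using c by (auto simp: unused_def)
      then have nQ: "Q \<inter> live f = {}" using none by (auto simp: live_def)
      obtain x where x: "x \<in> free f" using free by blast
      then have xV: "x \<in> V - dom f" and xv: "x \<in> nbhd E v" using nbhd_subset by (auto simp: free_def)
      have ct: "can_take E k f x c" using cr c by (auto simp: can_take_def ran_def)
      have "inj_on (f(x \<mapsto> c)) (pend (f(x \<mapsto> c)))"
        unfolding nbr_pend[OF f xV ct xv] none(1) by simp
      moreover have "card (cols f) < card (cols (f(x \<mapsto> c)))"
        using c(3) finite_cols[OF f] xv by (simp add: cols_upd[OF f xV ct])
      moreover have "Psi (f(x \<mapsto> c)) Q \<le> t"
        using nbr_Psi(1)[OF f xV ct xv Q] single(3) pc by simp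
      ultimately show ?thesis using xV ct nQ by (intro bexI[of _ x] exI[of _ c]) auto
    qed
  qed
qed

text \<open>
  \<open>M\<close> collects disjoint flagged pairs, so it has fewer than \<open>z\<close> members; each new member is paid for by
  the term \<open>8 * (z - card M)\<close> of \<open>total\<close>.
\<close>

definition valid :: "('a \<Rightarrow> nat option) \<Rightarrow> 'a set set \<Rightarrow> bool" where
  "valid f M \<longleftrightarrow> disjoint M \<and> (\<forall>T\<in>M. \<exists>w\<in>V. \<exists>w'\<in>V. T = {w, w'} \<and> card (res f w w') \<le> 16 * z + 5)"

definition total :: "('a \<Rightarrow> nat option) \<Rightarrow> 'a set set \<Rightarrow> nat" where
  "total f M = Psi f (\<Union>M) + 8 * (z - card M)"

section \<open>Flagged pairs and Bob's invariant\<close>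

lemma valid_subset: "valid f M \<Longrightarrow> \<Union>M \<subseteq> V"
  by (auto simp: valid_def)

lemma valid_finite: "valid f M \<Longrightarrow> finite M"
  using valid_subset finV by (meson finite_UnionD finite_subset)

lemma valid_card:
  assumes "valid f M" "r \<le> card (free f)"
  shows "card M < z"
  using assms few_flagged[of "free f" M] nbhd_subset by (auto simp: valid_def res_def free_def)

text \<open>Greedy: a live pair with small reserve outside \<open>\<Union>M\<close> is added. Each
  of its vertices is uncoloured or pending, not both, so it raises \<open>Psi\<close> by at most 4;
  the pair costs at most the 8 by which the other term of \<open>total\<close> drops.
  \<open>few_flagged\<close> makes the process end.\<close>

lemma flag:
  assumes "base f" "r \<le> card (free f)" "valid f M"
  shows "\<exists>M'. valid f M' \<and> total f M' \<le> total f M \<and>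
    (\<forall>w\<in>live f - \<Union>M'. \<forall>w'\<in>live f - \<Union>M'. 16 * z + 5 < card (res f w w'))"
  using assms(3)
proof (induction "z - card M" arbitrary: M rule: less_induct)
  case less
  show ?case
  proof (cases "\<forall>w\<in>live f - \<Union>M. \<forall>w'\<in>live f - \<Union>M. 16 * z + 5 < card (res f w w')")
    case True
    then show ?thesis using less.prems by blast
  next
    case False
    then obtain w w' where w: "w \<in> live f" "w' \<in> live f" "w \<notin> \<Union>M" "w' \<notin> \<Union>M" "card (res f w w') \<le> 16 * z + 5"
      by (auto simp: not_less)
    have lV: "live f \<subseteq> V" using baseD(2,9)[OF assms(1)] by (auto simp: live_def)
    let ?M = "insert {w, w'} M"
    let ?Q = "\<Union>M"
    have "disjoint ?M"
    proof -
      have "{w, w'} \<inter> T = {}" if "T \<in> M" for T using that w by blast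
      then show ?thesis using less.prems by (auto simp: valid_def disjoint_def Int_commute)
    qed
    moreover have "w \<in> V" "w' \<in> V" using w lV by auto
    ultimately have val: "valid f ?M"
      using less.prems w(5) unfolding valid_def by blast
    have cM: "card M < z" by (rule valid_card[OF less.prems assms(2)])
    have "{w, w'} \<notin> M" using w by auto
    then have card: "card ?M = card M + 1" using valid_finite[OF less.prems] by simp
    have Q: "\<Union>?M = {w, w'} \<union> ?Q" by simp
    have fQ: "finite ?Q" using valid_subset[OF less.prems] finV finite_subset by blast
    have "card (({w, w'} \<union> ?Q) - dom f) \<le> card ({w, w'} - dom f) + card (?Q - dom f)"
      unfolding Un_Diff by (rule card_Un_le)
    moreover have "card (({w, w'} \<union> ?Q) \<inter> pend f) \<le> card ({w, w'} \<inter> pend f) + card (?Q \<inter> pend f)"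
      unfolding Int_Un_distrib2 by (rule card_Un_le)
    moreover have "card ({w, w'} - dom f) + card ({w, w'} \<inter> pend f) \<le> 2"
    proof -
      have "card ({w, w'} - dom f) + card ({w, w'} \<inter> pend f) = card (({w, w'} - dom f) \<union> ({w, w'} \<inter> pend f))"
        using baseD(9)[OF assms(1)] by (intro card_Un_disjoint[symmetric]) auto
      also have "\<dots> \<le> card {w, w'}" by (intro card_mono) auto
      also have "\<dots> \<le> 2" by (simp add: card_insert_if)
      finally show ?thesis .
    qed
    ultimately have "Psi f (\<Union>?M) \<le> Psi f ?Q + 8" unfolding Psi_def Q by linarith
    then have tot: "total f ?M \<le> total f M" using cM card by (simp add: total_def)
    have "z - card ?M < z - card M" using cM card by simp
    from less.hyps[OF this val] tot show ?thesis by (meson order_trans)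
  qed
qed

text \<open>Describes positions before a move of Alice, after \<open>b\<close> exchanges. An
  exchange takes at most two vertices from a reserve, and \<open>total\<close> falls by 1 while
  \<open>\<Union>M\<close> has a live vertex; hence the factor 2. The inequality with
  \<open>b\<close> says that an exchange without a new colour next to \<open>v\<close> is paid for
  by \<open>total\<close>.\<close>

definition Inv :: "('a \<Rightarrow> nat option) \<Rightarrow> 'a set set \<Rightarrow> nat \<Rightarrow> bool" where
  "Inv f M b \<longleftrightarrow> base f \<and> valid f M \<and> inj_on f (pend f) \<and>
     (\<forall>w\<in>live f - \<Union>M. \<forall>w'\<in>live f - \<Union>M. 16 * z + 5 < card (res f w w')) \<and>
     (\<forall>w\<in>live f. \<forall>w'\<in>live f. 2 * total f M + 2 \<le> card (res f w w')) \<and>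
     total f M \<le> 8 * z + 1 \<and> b + total f M \<le> card (cols f) + (8 * z + 1) \<and> card (dom f) = 2 * b"

lemma card_free:
  assumes "base f"
  shows "card (nbhd E v) \<le> card (free f) + card (dom f)"
proof -
  have "card (nbhd E v) \<le> card (free f \<union> dom f)"
    using baseD(5)[OF assms] finite_free[of f] by (intro card_mono) (auto simp: free_def)
  also have "\<dots> \<le> card (free f) + card (dom f)" by (rule card_Un_le)
  finally show ?thesis .
qed

text \<open>The second half of an exchange, with the first half abstracted into
  \<open>threat\<close> and the bounds on reserves, so that it serves the opening move as well as
  later ones.\<close>

lemma bob_restores_Inv:
  assumes f: "base f" and val: "valid f M" and threat: "threat f (\<Union>M) t" and nwon: "\<not> won f"
    and t: "t + 8 * (z - card M) \<le> 8 * z + 1"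
    and res1: "\<And>w w'. w \<in> live f \<Longrightarrow> w' \<in> live f \<Longrightarrow> 2 * (t + 8 * (z - card M)) + 1 \<le> card (res f w w')"
    and res2: "\<And>w w'. w \<in> live f - \<Union>M \<Longrightarrow> w' \<in> live f - \<Union>M \<Longrightarrow> 16 * z + 5 \<le> card (res f w w')"
    and b: "b + (t + 8 * (z - card M)) \<le> card (cols f) + (8 * z + 1)" "card (dom f) = 2 * b + 1"
  shows "\<exists>x\<in>V - dom f. \<exists>c M'. can_take E k f x c \<and> Inv (f(x \<mapsto> c)) M' (b + 1)"
proof -
  let ?Q = "\<Union>M"
  have "card (cols f) \<le> k" using cols_subset[OF f] card_mono[of "{1..k}" "cols f"] by simp
  \<comment> \<open>As at most \<open>k\<close> colours are next to \<open>v\<close>, at most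
    \<open>k + 8 * z + 1\<close> exchanges lie behind. The degree of \<open>v\<close> then leaves
    \<open>r + 1\<close> free neighbours, one for Bob's move and \<open>r\<close> for
    \<open>few_flagged\<close>.\<close>
  then have "2 * b + 2 + r \<le> card (nbhd E v)" using b degree[OF v] by linarith
  then have free: "r + 1 \<le> card (free f)" using card_free[OF f] b(2) by linarith
  have fne: "free f \<noteq> {}" using free by auto
  have rne: "res f w w' \<noteq> {}" if "w \<in> live f" "w' \<in> live f" for w w' using res1[OF that] by auto
  from bob_move[OF f valid_subset[OF val] threat rne fne nwon]
  obtain x c where x: "x \<in> V - dom f" and c: "can_take E k f x c"
    and inj: "inj_on (f(x \<mapsto> c)) (pend (f(x \<mapsto> c)))"
    and P1: "Psi (f(x \<mapsto> c)) ?Q \<le> t"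
    and P2: "?Q \<inter> live f \<noteq> {} \<longrightarrow> Psi (f(x \<mapsto> c)) ?Q + 1 \<le> t"
    and P3: "card (cols f) < card (cols (f(x \<mapsto> c))) \<or> Psi (f(x \<mapsto> c)) ?Q + 1 \<le> t" by blast
  let ?f = "f(x \<mapsto> c)"
  have f': "base ?f" by (rule base_upd[OF f x c])
  have cols: "card (cols f) \<le> card (cols ?f)"
    using cols_mono[OF f x c] finite_cols[OF f'] by (rule card_mono[rotated])
  have val': "valid ?f M"
    using val res_upd_le[OF f x c] unfolding valid_def by (meson order_trans)
  have "free ?f = free f - {x}" by (rule free_upd[OF f x c])
  then have "card (free f) \<le> card (free ?f) + 1"
    using diff_card_le_card_Diff[of "{x}" "free f"] by simp
  then have "r \<le> card (free ?f)" using free by linarith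
  from flag[OF f' this val'] obtain M' where M': "valid ?f M'" "total ?f M' \<le> total ?f M"
    "\<forall>w\<in>live ?f - \<Union>M'. \<forall>w'\<in>live ?f - \<Union>M'. 16 * z + 5 < card (res ?f w w')" by blast
  have tot: "total ?f M \<le> t + 8 * (z - card M)" using P1 by (simp add: total_def)
  have "2 * total ?f M + 2 \<le> card (res ?f w w')" if w: "w \<in> live ?f" "w' \<in> live ?f" for w w'
  proof -
    have l: "w \<in> live f" "w' \<in> live f" using w live_upd[OF f x c] by auto
    show ?thesis
    proof (cases "?Q \<inter> live f = {}")
      case False
      then have "total ?f M + 1 \<le> t + 8 * (z - card M)" using P2 by (simp add: total_def)
      then have "2 * (total ?f M + 1) + 1 \<le> 2 * (t + 8 * (z - card M)) + 1" by simp
      also have "\<dots> \<le> card (res ?f w w') + 1"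
        using res1[OF l] res_upd[OF f x c, of w w'] by (rule order_trans)
      finally show ?thesis by simp
    next
      case True
      then have "w \<in> live f - ?Q" "w' \<in> live f - ?Q" using l by auto
      \<comment> \<open>Here all live pairs are unflagged. Their reserve after Bob's move is at
        least \<open>16 * z + 4\<close>, which is \<open>2 * (8 * z + 1) + 2\<close>, enough for
        every admissible value of \<open>total\<close>.\<close>
      from res2[OF this] show ?thesis using res_upd[OF f x c, of w w'] tot t by linarith
    qed
  qed
  then have R: "\<forall>w\<in>live ?f. \<forall>w'\<in>live ?f. 2 * total ?f M' + 2 \<le> card (res ?f w w')"
    using M'(2) by (meson add_le_mono1 mult_le_mono2 order_trans)
  have "b + 1 + total ?f M \<le> card (cols ?f) + (8 * z + 1)"
    using P3
  proof
    assume "card (cols f) < card (cols ?f)"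
    then show ?thesis using b(1) tot by linarith
  next
    assume "Psi ?f ?Q + 1 \<le> t"
    then have "total ?f M + 1 \<le> t + 8 * (z - card M)" by (simp add: total_def)
    then show ?thesis using b(1) cols by linarith
  qed
  then have "b + 1 + total ?f M' \<le> card (cols ?f) + (8 * z + 1)" using M'(2) by linarith
  moreover have "total ?f M' \<le> 8 * z + 1" using M'(2) tot t by linarith
  moreover have "card (dom ?f) = 2 * (b + 1)" using card_dom_upd[OF f x c] b(2) by simp
  ultimately have "Inv ?f M' (b + 1)" unfolding Inv_def using f' M' inj R by blast
  then show ?thesis using x c by blast
qed

lemma Inv_round:
  assumes I: "Inv f M b" and y: "y \<in> V - dom f" and c: "can_take E k f y c" and nwon: "\<not> won (f(y \<mapsto> c))"
  shows "\<exists>x\<in>V - dom (f(y \<mapsto> c)). \<exists>d M'. can_take E k (f(y \<mapsto> c)) x d \<and> Inv (f(y \<mapsto> c, x \<mapsto> d)) M' (b + 1)"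
proof -
  let ?f = "f(y \<mapsto> c)"
  have f: "base f" and val: "valid f M" and inj: "inj_on f (pend f)"
    and res2: "\<And>w w'. w \<in> live f - \<Union>M \<Longrightarrow> w' \<in> live f - \<Union>M \<Longrightarrow> 16 * z + 5 < card (res f w w')"
    and res1: "\<And>w w'. w \<in> live f \<Longrightarrow> w' \<in> live f \<Longrightarrow> 2 * total f M + 2 \<le> card (res f w w')"
    and tot: "total f M \<le> 8 * z + 1" and b: "b + total f M \<le> card (cols f) + (8 * z + 1)" "card (dom f) = 2 * b"
    using I unfolding Inv_def by blast+
  have f': "base ?f" by (rule base_upd[OF f y c])
  show ?thesis
  proof (rule bob_restores_Inv[OF f' _ _ nwon, where t = "Psi f (\<Union>M)" and M = M])
    show "valid ?f M" using val res_upd_le[OF f y c] unfolding valid_def by (meson order_trans)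
    show "threat ?f (\<Union>M) (Psi f (\<Union>M))"
      by (rule threat_if_alice_moves[OF f y c inj valid_subset[OF val]])
    show "Psi f (\<Union>M) + 8 * (z - card M) \<le> 8 * z + 1" using tot by (simp add: total_def)
    show "2 * (Psi f (\<Union>M) + 8 * (z - card M)) + 1 \<le> card (res ?f w w')"
      if "w \<in> live ?f" "w' \<in> live ?f" for w w'
    proof -
      have "w \<in> live f" "w' \<in> live f" using that live_upd[OF f y c] by auto
      from res1[OF this] show ?thesis using res_upd[OF f y c, of w w'] unfolding total_def by linarith
    qed
    show "16 * z + 5 \<le> card (res ?f w w')" if "w \<in> live ?f - \<Union>M" "w' \<in> live ?f - \<Union>M" for w w'
    proof -
      have "w \<in> live f - \<Union>M" "w' \<in> live f - \<Union>M" using that live_upd[OF f y c] by auto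
      from res2[OF this] show ?thesis using res_upd[OF f y c, of w w'] by linarith
    qed
    have "card (cols f) \<le> card (cols ?f)"
      using cols_mono[OF f y c] finite_cols[OF f'] by (rule card_mono[rotated])
    then show "b + (Psi f (\<Union>M) + 8 * (z - card M)) \<le> card (cols ?f) + (8 * z + 1)"
      using b(1) unfolding total_def by linarith
    show "card (dom ?f) = 2 * b + 1" using card_dom_upd[OF f y c] b(2) by simp
  qed
qed

lemma Inv_start:
  assumes c0: "c0 \<in> {1..k}" and nwon: "\<not> won [v \<mapsto> c0]"
  shows "\<exists>x\<in>V - dom [v \<mapsto> c0]. \<exists>d M. can_take E k [v \<mapsto> c0] x d \<and> Inv [v \<mapsto> c0, x \<mapsto> d] M 1"
proof -
  let ?f = "[v \<mapsto> c0]"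
  have f: "base ?f"
    using v c0 nbhd_irrefl by (auto simp: base_def proper_iff)
  have pend: "pend ?f = {}" "pcols ?f = {}" by (auto simp: pend_def pcols_def)
  have P: "Psi ?f {} \<le> 1" by (simp add: Psi_def pend)
  have res: "16 * z + 7 \<le> card (res ?f w w')" if "w \<in> live ?f" "w' \<in> live ?f" for w w'
  proof -
    have "res ?f w w' = nbhd E v - nbhd E w - nbhd E w' - {w, w'}"
      using nbhd_irrefl by (auto simp: res_def free_def)
    then show ?thesis using priv[OF v, of w w'] that pend by (auto simp: live_def)
  qed
  have "\<exists>x\<in>V - dom ?f. \<exists>c M'. can_take E k ?f x c \<and> Inv (?f(x \<mapsto> c)) M' (0 + 1)"
  proof (rule bob_restores_Inv[OF f _ _ nwon, where t = 1 and M = "{}"])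
    show "valid ?f {}" by (simp add: valid_def disjoint_def)
    show "threat ?f (\<Union>{}) 1" using P pend by (simp add: threat_def)
    fix w w' assume w: "w \<in> live ?f" "w' \<in> live ?f"
    then show "2 * (1 + 8 * (z - card {})) + 1 \<le> card (res ?f w w')" using res by fastforce
  next
    fix w w' assume "w \<in> live ?f - \<Union>{}" "w' \<in> live ?f - \<Union>{}"
    then show "16 * z + 5 \<le> card (res ?f w w')" using res by fastforce
  qed auto
  then show ?thesis by simp
qed

end

section \<open>From Bob's invariant to his win in the second round\<close>

lemma chosen_first_round: "length h < card V \<Longrightarrow> chosen_this_round V h = dom (colouring h)"
  by (simp add: chosen_this_round_def dom_colouring)

context fin_graph
begin

lemma legal_move_first_round:
  assumes "proper E (colouring h)" "length h < card V"
  shows "legal_move V E k h (y, c) \<longleftrightarrow> y \<in> V - dom (colouring h) \<and> can_take E k (colouring h) y c"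
  using assms by (auto simp: legal_move_def available_def chosen_first_round legal_colour_iff)

lemma legal_move_step:
  assumes "dom (colouring h) \<subseteq> V \<and> card (dom (colouring h)) = length h \<and> proper E (colouring h) \<and> ran (colouring h) \<subseteq> {1..k}"
    "length h < card V" "legal_move V E k h m"
  shows "dom (colouring (h @ [m])) \<subseteq> V \<and> card (dom (colouring (h @ [m]))) = Suc (length h) \<and>
    proper E (colouring (h @ [m])) \<and> ran (colouring (h @ [m])) \<subseteq> {1..k}"
proof -
  obtain y c where m: "m = (y, c)" by (cases m)
  have y: "y \<in> V - dom (colouring h)" "can_take E k (colouring h) y c"
    using legal_move_first_round assms m by blast+
  have "finite (dom (colouring h))" using assms finV finite_subset by blast
  moreover have "ran ((colouring h)(y \<mapsto> c)) = insert c (ran (colouring h))"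
    using y by (intro ran_map_upd) auto
  moreover have "c \<in> {1..k}" using y by (simp add: can_take_def)
  ultimately show ?thesis
    using assms y m proper_upd by (auto simp: colouring_snoc)
qed

lemma follows_first_round:
  assumes "follows V E k \<sigma> h" "length h \<le> card V"
  shows "dom (colouring h) \<subseteq> V" "card (dom (colouring h)) = length h" "proper E (colouring h)"
    "ran (colouring h) \<subseteq> {1..k}"
proof -
  have "dom (colouring h) \<subseteq> V \<and> card (dom (colouring h)) = length h \<and> proper E (colouring h) \<and> ran (colouring h) \<subseteq> {1..k}"
    using assms
  proof induction
    case start
    then show ?case by (simp add: proper_def)
  next
    case (alice h)
    then show ?case using legal_move_step[of h k "\<sigma> h"] by simp
  next
    case (bob h m)
    then show ?case using legal_move_step[of h k m] by simp
  qed
  then show "dom (colouring h) \<subseteq> V" "card (dom (colouring h)) = length h" "proper E (colouring h)"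
    "ran (colouring h) \<subseteq> {1..k}" by auto
qed

end

lemma (in lower_graph) bob_wins:
  assumes odd: "odd (card V)"
  shows "\<not> winning_strategy V E k \<sigma>"
proof
  assume win: "winning_strategy V E k \<sigma>"
  have alice_legal: "legal_move V E k h (\<sigma> h)" if "follows V E k \<sigma> h" "even (length h)" for h
    using win that by (auto simp: winning_strategy_def)
  have not_stuck: "\<not> stuck V E k h u" if "follows V E k \<sigma> h" "odd (length h)" for h u
    using win that by (auto simp: winning_strategy_def)
  define n where "n = card V"
  have n: "0 < n" using odd by (auto simp: n_def intro: Nat.gr0I)
  obtain v c0 where \<sigma>0: "\<sigma> [] = (v, c0)" by (cases "\<sigma> []")
  have proper0: "proper E (colouring [])" by (simp add: proper_def)
  have "legal_move V E k [] (v, c0)" using alice_legal[OF follows.start] \<sigma>0 by simp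
  then have vV: "v \<in> V" and c0: "can_take E k Map.empty v c0"
    using legal_move_first_round[OF proper0] n by (auto simp: n_def)
  interpret lower_game V E k z r v c0
    by unfold_locales (rule vV)
  have first: "follows V E k \<sigma> [(v, c0)]"
  proof -
    have "follows V E k \<sigma> ([] @ [\<sigma> []])"
      by (rule follows.alice[OF follows.start]) (use alice_legal[OF follows.start] in auto)
    then show ?thesis unfolding \<sigma>0 by simp
  qed
  have base: "base (colouring h)" if "follows V E k \<sigma> h" "length h \<le> n" "colouring h v = Some c0" for h
    using follows_first_round[OF that(1)] that by (simp add: base_def n_def)
  have Bob: "follows V E k \<sigma> (h @ [(x, d)])"
    if "follows V E k \<sigma> h" "odd (length h)" "length h < n" "x \<in> V - dom (colouring h)" "can_take E k (colouring h) x d" for h x d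
    using follows.bob[OF that(1,2)] legal_move_first_round follows_first_round(3)[OF that(1)] that by (simp add: n_def)
  have loop: "(\<exists>h. follows V E k \<sigma> h \<and> length h \<le> n \<and> won (colouring h) \<and> colouring h v = Some c0) \<or>
      (\<exists>h M. follows V E k \<sigma> h \<and> length h = 2 * Suc b \<and> Inv (colouring h) M (Suc b))" for b
  proof (induction b)
    case 0
    have f1: "colouring [(v, c0)] = [v \<mapsto> c0]" by (simp add: colouring_def)
    show ?case
    proof (cases "won [v \<mapsto> c0]")
      case True
      then have "won (colouring [(v, c0)])" by (simp only: f1)
      moreover have "colouring [(v, c0)] v = Some c0" by (simp add: f1)
      moreover have "length [(v, c0)] \<le> n" using n by simp
      ultimately show ?thesis using first by blast
    next
      case False
      from Inv_start[OF _ False] c0 obtain x d M where x: "x \<in> V - dom [v \<mapsto> c0]"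
        "can_take E k [v \<mapsto> c0] x d" "Inv [v \<mapsto> c0, x \<mapsto> d] M 1" by (auto simp: can_take_def)
      have "card {v, x} \<le> n" unfolding n_def using x vV finV by (intro card_mono) auto
      moreover have "card {v, x} = 2" using x by auto
      ultimately have "1 < n" by simp
      then have "follows V E k \<sigma> ([(v, c0)] @ [(x, d)])"
        using Bob[OF first, of x d] x f1 by simp
      moreover
      have "colouring ([(v, c0)] @ [(x, d)]) = [v \<mapsto> c0, x \<mapsto> d]"
        by (simp only: colouring_snoc f1 fst_conv snd_conv)
      then have "Inv (colouring ([(v, c0)] @ [(x, d)])) M (Suc 0)" using x(3) by (simp only: One_nat_def)
      moreover have "length ([(v, c0)] @ [(x, d)]) = 2 * Suc 0" by simp
      ultimately show ?thesis by blast
    qed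
  next
    case (Suc b)
    show ?case
    proof (cases "\<exists>h. follows V E k \<sigma> h \<and> length h \<le> n \<and> won (colouring h) \<and> colouring h v = Some c0")
      case True
      then show ?thesis by blast
    next
      case nw: False
      with Suc obtain h M where h: "follows V E k \<sigma> h" "length h = 2 * Suc b" "Inv (colouring h) M (Suc b)" by blast
      let ?f = "colouring h"
      have f: "base ?f" and d: "card (dom ?f) = length h" using h by (auto simp: Inv_def)
      have inV: "dom ?f \<subseteq> V" using f by (simp add: base_def)
      have le: "length h \<le> n" using d inV finV card_mono unfolding n_def by metis
      \<comment> \<open>The invariant lives at even lengths and \<open>n\<close> is odd, so Alice
        still has to move in the first round.\<close>
      have lt: "length h < n" using le h(2) odd unfolding n_def by (metis dvd_triv_left le_neq_implies_less)
      obtain y c where y: "\<sigma> h = (y, c)" by (cases "\<sigma> h")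
      have leg: "legal_move V E k h (y, c)" using alice_legal[OF h(1)] h(2) y by simp
      then have yV: "y \<in> V - dom ?f" and yc: "can_take E k ?f y c"
        using legal_move_first_round[OF follows_first_round(3)[OF h(1)]] lt by (auto simp: n_def)
      have h1: "follows V E k \<sigma> (h @ [(y, c)])"
        using follows.alice[OF h(1)] leg h(2) y by simp
      have f1: "colouring (h @ [(y, c)]) = ?f(y \<mapsto> c)" by (simp add: colouring_snoc)
      have "base (?f(y \<mapsto> c))" by (rule base_upd[OF f yV yc])
      then have "\<not> won (?f(y \<mapsto> c))"
        using nw h1 lt f1 by (metis Suc_leI base_def length_append_singleton)
      from Inv_round[OF h(3) yV yc this] obtain x d M' where x: "x \<in> V - dom (?f(y \<mapsto> c))"
        "can_take E k (?f(y \<mapsto> c)) x d" "Inv (?f(y \<mapsto> c, x \<mapsto> d)) M' (Suc b + 1)" by blast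
      \<comment> \<open>That an uncoloured \<open>x\<close> is left for Bob shows that his reply
        also falls into the first round.\<close>
      have "card (insert x (dom (?f(y \<mapsto> c)))) \<le> n"
        unfolding n_def using x yV inV finV by (intro card_mono) auto
      moreover have "card (insert x (dom (?f(y \<mapsto> c)))) = Suc (Suc (length h))"
        using x card_dom_upd[OF f yV yc] d baseD(5)[OF \<open>base (?f(y \<mapsto> c))\<close>] by simp
      ultimately have "length (h @ [(y, c)]) < n" by simp
      then have "follows V E k \<sigma> ((h @ [(y, c)]) @ [(x, d)])"
        using Bob[OF h1, of x d] x h(2) f1 by simp
      moreover have "colouring ((h @ [(y, c)]) @ [(x, d)]) = ?f(y \<mapsto> c, x \<mapsto> d)"
        by (simp only: colouring_snoc[of "h @ [(y, c)]"] f1 fst_conv snd_conv)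
      then have "Inv (colouring ((h @ [(y, c)]) @ [(x, d)])) M' (Suc (Suc b))"
        using x(3) by (simp only: Suc_eq_plus1)
      moreover have "length ((h @ [(y, c)]) @ [(x, d)]) = 2 * Suc (Suc b)" using h(2) by simp
      ultimately show ?thesis by blast
    qed
  qed
  have "\<exists>h. follows V E k \<sigma> h \<and> length h \<le> n \<and> won (colouring h) \<and> colouring h v = Some c0"
  proof (rule ccontr)
    assume "\<not> ?thesis"
    \<comment> \<open>One exchange more than the potential allows would put more than
      \<open>k\<close> colours next to \<open>v\<close>.\<close>
    with loop[of "k + 8 * z + 1"] obtain h M where "Inv (colouring h) M (Suc (k + 8 * z + 1))" by blast
    then have "Suc (k + 8 * z + 1) \<le> card (cols (colouring h)) + (8 * z + 1)" "base (colouring h)"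
      by (auto simp: Inv_def)
    moreover from this have "card (cols (colouring h)) \<le> k"
      using cols_subset card_mono[of "{1..k}" "cols (colouring h)"] by simp
    ultimately show False by linarith
  qed
  then obtain h where h: "follows V E k \<sigma> h" "length h \<le> n" "won (colouring h)" "colouring h v = Some c0" by blast
  \<comment> \<open>Nothing is recoloured in the first round, so the remaining moves are filler and
    cannot undo the win. Bob always finds one, since a stuck vertex would already contradict Alice's
    strategy.\<close>
  have "\<exists>h. follows V E k \<sigma> h \<and> length h = n \<and> won (colouring h) \<and> colouring h v = Some c0"
    using h
  proof (induction "n - length h" arbitrary: h)
    case 0
    then show ?case by (intro exI[of _ h]) auto
  next
    case (Suc m)
    then have lt: "length h < n" by simp
    have step: ?case if "follows V E k \<sigma> (h @ [(y, c)])" "y \<in> V - dom (colouring h)" "can_take E k (colouring h) y c" for y c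
    proof (rule Suc.hyps(1)[OF _ that(1)])
      have f: "base (colouring h)" using base Suc.prems by blast
      show "m = n - length (h @ [(y, c)])" "length (h @ [(y, c)]) \<le> n" using Suc.hyps(2) lt by auto
      show "won (colouring (h @ [(y, c)]))"
        using Suc.prems(3) cols_mono[OF f that(2,3)] by (auto simp: won_def colouring_snoc)
      show "colouring (h @ [(y, c)]) v = Some c0"
        using Suc.prems(4) that(2) by (auto simp: colouring_snoc)
    qed
    note fr = follows_first_round[OF Suc.prems(1)]
    have legal: "legal_move V E k h (y, c) \<longleftrightarrow> y \<in> V - dom (colouring h) \<and> can_take E k (colouring h) y c" for y c
      using legal_move_first_round fr(3) lt by (simp add: n_def)
    show ?case
    proof (cases "even (length h)")
      case True
      obtain y c where y: "\<sigma> h = (y, c)" by (cases "\<sigma> h")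
      have leg: "legal_move V E k h (y, c)" using alice_legal[OF Suc.prems(1) True] y by simp
      then have "follows V E k \<sigma> (h @ [(y, c)])" using follows.alice[OF Suc.prems(1) True] y by simp
      then show ?thesis using step leg legal by blast
    next
      case False
      have "dom (colouring h) \<noteq> V" using fr(2) lt by (auto simp: n_def)
      then obtain y where y: "y \<in> V" "y \<notin> dom (colouring h)" using fr(1) lt by (auto simp: n_def)
      have "available V h y" using y lt by (simp add: available_def chosen_first_round n_def)
      then obtain c where "legal_colour E k h y c" using not_stuck[OF Suc.prems(1) False, of y] by (auto simp: stuck_def)
      then have "legal_move V E k h (y, c)" using \<open>available V h y\<close> by (simp add: legal_move_def)
      then show ?thesis using step follows.bob[OF Suc.prems(1) False] legal by blast
    qed
  qed
  then obtain h where h: "follows V E k \<sigma> h" "length h = n" "won (colouring h)" "colouring h v = Some c0" by blast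
  have "chosen_this_round V h = {}" using h(2) n by (simp add: chosen_this_round_def n_def)
  then have "available V h v" using vV by (simp add: available_def)
  moreover have "\<not> legal_colour E k h v c" for c
    using h(3,4) legal_colour_iff[OF follows_first_round(3)[OF h(1)]] h(2)
    by (auto simp: won_def cols_def can_take_def n_def)
  ultimately have "stuck V E k h v" by (simp add: stuck_def)
  moreover have "odd (length h)" using h(2) odd by (simp add: n_def)
  ultimately show False using not_stuck[OF h(1)] by blast
qed

section \<open>Typical random graphs\<close>

lemma prob_pair_pmf_times:
  "measure_pmf.prob (pair_pmf M N) (A \<times> B) = measure_pmf.prob M A * measure_pmf.prob N B"
proof -
  have "measure_pmf.prob (pair_pmf M N) (A \<times> B)
      = measure_pmf.prob (pair_pmf M N) ((A \<times> B) \<inter> set_pmf (pair_pmf M N))"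
    by (rule measure_Int_set_pmf [symmetric])
  also have "(A \<times> B) \<inter> set_pmf (pair_pmf M N) = (A \<inter> set_pmf M) \<times> (B \<inter> set_pmf N)"
    by auto
  also have "measure_pmf.prob (pair_pmf M N) \<dots>
      = measure_pmf.prob M (A \<inter> set_pmf M) * measure_pmf.prob N (B \<inter> set_pmf N)"
    by (rule measure_pmf_prob_product) auto
  finally show ?thesis by (simp add: measure_Int_set_pmf)
qed

lemma prob_pattern_le:
  assumes "finite F" "card F \<le> m" "0 < p" "p < 1"
  shows "measure_pmf.prob (Pi_pmf F False (\<lambda>_. bernoulli_pmf p)) {X. \<exists>e\<in>F. X e \<noteq> s e}
    \<le> 1 - min p (1 - p) ^ m"
proof -
  let ?P = "measure_pmf.prob (Pi_pmf F False (\<lambda>_. bernoulli_pmf p))"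
  have q: "0 < min p (1 - p)" "min p (1 - p) \<le> 1" using assms by auto
  have "min p (1 - p) ^ m \<le> min p (1 - p) ^ card F"
    using assms q by (intro power_decreasing) auto
  also have "\<dots> = (\<Prod>e\<in>F. min p (1 - p))" by simp
  also have "\<dots> \<le> (\<Prod>e\<in>F. measure_pmf.prob (bernoulli_pmf p) {s e})"
  proof (intro prod_mono conjI)
    fix e show "min p (1 - p) \<le> measure_pmf.prob (bernoulli_pmf p) {s e}"
      using assms by (cases "s e") (auto simp: measure_pmf_single)
  qed (use q in auto)
  also have "\<dots> = ?P (Pi F (\<lambda>e. {s e}))"
    using assms by (subst measure_Pi_pmf_Pi) auto
  finally have "min p (1 - p) ^ m \<le> ?P (Pi F (\<lambda>e. {s e}))" .
  moreover have "{X. \<exists>e\<in>F. X e \<noteq> s e} = space (measure_pmf (Pi_pmf F False (\<lambda>_. bernoulli_pmf p))) - Pi F (\<lambda>e. {s e})"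
    by (auto simp: Pi_def)
  ultimately show ?thesis by (simp only: measure_pmf.prob_compl sets_measure_pmf UNIV_I)
qed

text \<open>The product measure is split into the coordinates in \<open>F j\<close> and the others.
  By disjointness the remaining patterns depend on the others only, so each index contributes one
  factor.\<close>

lemma prob_disjoint_patterns_le:
  assumes "finite J" "finite I" "0 < p" "p < 1"
    and "\<And>j. j \<in> J \<Longrightarrow> F j \<subseteq> I" "\<And>j. j \<in> J \<Longrightarrow> card (F j) \<le> m" "disjoint_family_on F J"
  shows "measure_pmf.prob (Pi_pmf I False (\<lambda>_. bernoulli_pmf p)) {X. \<forall>j\<in>J. \<exists>e\<in>F j. X e \<noteq> s e}
    \<le> (1 - min p (1 - p) ^ m) ^ card J"
  using assms
proof (induction J arbitrary: I rule: finite_induct)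
  case empty
  then show ?case by simp
next
  case (insert j J)
  let ?p = "\<lambda>_. bernoulli_pmf p"
  let ?b = "1 - min p (1 - p) ^ m"
  let ?h = "\<lambda>(f, g) e. if e \<in> F j then f e else g e"
  let ?P1 = "Pi_pmf (F j) False ?p" and ?P2 = "Pi_pmf (I - F j) False ?p"
  let ?A = "{X. \<exists>e\<in>F j. X e \<noteq> s e}" and ?B = "{X. \<forall>j\<in>J. \<exists>e\<in>F j. X e \<noteq> s e}"
  have Fj: "F j \<subseteq> I" using insert.prems by auto
  then have fin: "finite (F j)" using insert.prems finite_subset by blast
  have disj: "F j' \<inter> F j = {}" if "j' \<in> J" for j'
    using insert.prems(6) insert.hyps(2) that by (auto simp: disjoint_family_on_def)
  have I: "I = F j \<union> (I - F j)" using Fj by auto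
  have eq: "?h -` {X. \<forall>j\<in>insert j J. \<exists>e\<in>F j. X e \<noteq> s e} = ?A \<times> ?B"
  proof (intro set_eqI iffI)
    fix z assume z: "z \<in> ?h -` {X. \<forall>j\<in>insert j J. \<exists>e\<in>F j. X e \<noteq> s e}"
    obtain f g where [simp]: "z = (f, g)" by (cases z)
    have "\<exists>e\<in>F j'. g e \<noteq> s e" if "j' \<in> J" for j'
    proof -
      have "\<forall>j\<in>insert j J. \<exists>e\<in>F j. ?h (f, g) e \<noteq> s e" using z by simp
      then obtain e where "e \<in> F j'" "?h (f, g) e \<noteq> s e" using \<open>j' \<in> J\<close> by blast
      moreover have "e \<notin> F j" using disj[OF that] \<open>e \<in> F j'\<close> by blast
      ultimately show ?thesis by (intro bexI[of _ e]) auto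
    qed
    then show "z \<in> ?A \<times> ?B" using z by auto
  next
    fix z assume z: "z \<in> ?A \<times> ?B"
    obtain f g where [simp]: "z = (f, g)" by (cases z)
    have "\<exists>e\<in>F j'. ?h (f, g) e \<noteq> s e" if "j' \<in> J" for j'
    proof -
      have "\<forall>j\<in>J. \<exists>e\<in>F j. g e \<noteq> s e" using z by simp
      then obtain e where "e \<in> F j'" "g e \<noteq> s e" using \<open>j' \<in> J\<close> by blast
      moreover have "e \<notin> F j" using disj[OF that] \<open>e \<in> F j'\<close> by blast
      ultimately show ?thesis by (intro bexI[of _ e]) auto
    qed
    then show "z \<in> ?h -` {X. \<forall>j\<in>insert j J. \<exists>e\<in>F j. X e \<noteq> s e}" using z by auto
  qed
  have "measure_pmf.prob (Pi_pmf I False ?p) {X. \<forall>j\<in>insert j J. \<exists>e\<in>F j. X e \<noteq> s e}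
    = measure_pmf.prob (map_pmf ?h (pair_pmf ?P1 ?P2)) {X. \<forall>j\<in>insert j J. \<exists>e\<in>F j. X e \<noteq> s e}"
    using insert.prems fin by (subst I, subst Pi_pmf_union) auto
  also have "\<dots> = measure_pmf.prob ?P1 ?A * measure_pmf.prob ?P2 ?B"
    by (simp only: measure_map_pmf eq prob_pair_pmf_times)
  also have "\<dots> \<le> ?b * ?b ^ card J"
  proof (rule mult_mono)
    show "measure_pmf.prob ?P1 ?A \<le> ?b"
      using fin insert.prems by (intro prob_pattern_le) auto
    show "measure_pmf.prob ?P2 ?B \<le> ?b ^ card J"
      using insert.prems disj
      by (intro insert.IH) (fastforce simp: disjoint_family_on_def)+
    show "0 \<le> ?b" using insert.prems by (simp add: power_le_one)
  qed auto
  finally show ?case using insert.hyps by simp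
qed

lemma prob_random_graph:
  "measure_pmf.prob (random_graph n p) {E. Q E} =
   measure_pmf.prob (Pi_pmf ([{..<n}]\<^bsup>2\<^esup>) False (\<lambda>_. bernoulli_pmf p)) {X. Q {e \<in> [{..<n}]\<^bsup>2\<^esup>. X e}}"
  unfolding random_graph_def by (simp add: vimage_def)

lemma random_graph_disjoint_patterns_le:
  assumes "finite J" "0 < p" "p < 1"
    and "\<And>j. j \<in> J \<Longrightarrow> F j \<subseteq> [{..<n}]\<^bsup>2\<^esup>" "\<And>j. j \<in> J \<Longrightarrow> card (F j) \<le> m" "disjoint_family_on F J"
  shows "measure_pmf.prob (random_graph n p) {E. \<forall>j\<in>J. \<exists>e\<in>F j. (e \<in> E) \<noteq> s e}
    \<le> (1 - min p (1 - p) ^ m) ^ card J"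
proof -
  have fin: "finite ([{..<n}]\<^bsup>2\<^esup>)" by (simp add: finite_imp_finite_nsets)
  have "measure_pmf.prob (random_graph n p) {E. \<forall>j\<in>J. \<exists>e\<in>F j. (e \<in> E) \<noteq> s e}
    = measure_pmf.prob (Pi_pmf ([{..<n}]\<^bsup>2\<^esup>) False (\<lambda>_. bernoulli_pmf p))
        {X. \<forall>j\<in>J. \<exists>e\<in>F j. (e \<in> {e \<in> [{..<n}]\<^bsup>2\<^esup>. X e}) \<noteq> s e}"
    by (rule prob_random_graph)
  also have "{X. \<forall>j\<in>J. \<exists>e\<in>F j. (e \<in> {e \<in> [{..<n}]\<^bsup>2\<^esup>. X e}) \<noteq> s e}
    = {X. \<forall>j\<in>J. \<exists>e\<in>F j. X e \<noteq> s e}"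
    using assms(4) by blast
  finally show ?thesis
    using prob_disjoint_patterns_le[OF assms(1) fin assms(2,3,4,5,6), where s=s] by simp
qed

text \<open>The degree counts successes among the \<open>n - 1\<close> independent edges at
  \<open>v\<close>; the estimate is Hoeffding's inequality for the binomial distribution.\<close>

lemma random_graph_degree:
  assumes "0 < p" "p < 1" "v < n" "1 < n" "0 \<le> \<epsilon>"
  shows "measure_pmf.prob (random_graph n p) {E. \<epsilon> * (real n - 1) \<le> \<bar>real (card (nbhd E v)) - p * (real n - 1)\<bar>}
    \<le> 2 * exp (- 2 * (real n - 1) * \<epsilon>\<^sup>2)"
proof -
  let ?I = "[{..<n}]\<^bsup>2\<^esup>"
  define S where "S = (\<lambda>u. {v, u}) ` ({..<n} - {v})"
  have fin: "finite ?I" by (simp add: finite_imp_finite_nsets)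
  have inj: "inj_on (\<lambda>u. {v, u}) A" for A by (auto simp: inj_on_def doubleton_eq_iff)
  have S: "S \<subseteq> ?I" "finite S" "card S = n - 1"
    unfolding S_def using \<open>v < n\<close> inj by (auto simp: card_image)
  have deg: "card (nbhd {e \<in> ?I. X e} v) = card {e \<in> S. X e}" for X
  proof -
    have "{e \<in> S. X e} = (\<lambda>u. {v, u}) ` nbhd {e \<in> ?I. X e} v"
      unfolding S_def nbhd_def using \<open>v < n\<close> by auto
    then show ?thesis using card_image[OF inj] by metis
  qed
  have bin: "binomial_pmf (n - 1) p = map_pmf (\<lambda>X. card {e \<in> S. X e}) (Pi_pmf ?I False (\<lambda>_. bernoulli_pmf p))"
  proof -
    have "binomial_pmf (n - 1) p = map_pmf (\<lambda>X. card {e \<in> S. X e}) (Pi_pmf S False (\<lambda>_. bernoulli_pmf p))"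
      by (rule binomial_pmf_altdef') (use S assms in auto)
    also have "\<dots> = map_pmf (\<lambda>X. card {e \<in> S. X e}) (Pi_pmf ?I False (\<lambda>_. bernoulli_pmf p))"
      by (subst Pi_pmf_subset[OF fin S(1)])
         (auto simp: map_pmf_comp intro!: map_pmf_cong arg_cong[where f=card])
    finally show ?thesis .
  qed
  interpret B: binomial_distribution "n - 1" p by unfold_locales (use assms in auto)
  have "measure_pmf.prob (random_graph n p) {E. \<epsilon> * (real n - 1) \<le> \<bar>real (card (nbhd E v)) - p * (real n - 1)\<bar>}
    = measure_pmf.prob (binomial_pmf (n - 1) p) {x. \<epsilon> * (real n - 1) \<le> \<bar>real x - p * (real n - 1)\<bar>}"
    unfolding bin prob_random_graph deg by (simp add: vimage_def)
  also have "{x::nat. \<epsilon> * (real n - 1) \<le> \<bar>real x - p * (real n - 1)\<bar>} = {x. \<bar>x / real (n - 1) - p\<bar> \<ge> \<epsilon>}"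
  proof -
    have "\<bar>x / real (n - 1) - p\<bar> = \<bar>x - p * (real n - 1)\<bar> / (real n - 1)" for x
    proof -
      have "x / real (n - 1) - p = (x - p * (real n - 1)) / (real n - 1)"
        using \<open>1 < n\<close> by (simp add: of_nat_diff field_simps)
      then show ?thesis using \<open>1 < n\<close> by simp
    qed
    then show ?thesis using \<open>1 < n\<close> by (auto simp: le_divide_eq)
  qed
  also have "measure_pmf.prob (binomial_pmf (n - 1) p) \<dots> \<le> 2 * exp (- 2 * real (n - 1) * \<epsilon>\<^sup>2)"
    using B.prob_abs_ge'[of \<epsilon>] assms by simp
  finally show ?thesis using \<open>1 < n\<close> by (simp add: of_nat_diff)
qed

text \<open>
  The empty set is excluded from \<open>\<T>\<close> so that the size of a disjoint family is bounded by the number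
  of vertices, which leaves at most \<open>(n + 1) ^ n\<close> families in the union bound.
\<close>

definition scattered :: "'a set \<Rightarrow> 'a set set \<Rightarrow> nat \<Rightarrow> real \<Rightarrow> bool" where
  "scattered V E M q \<longleftrightarrow> (\<forall>Z \<T>. Z \<subseteq> V \<longrightarrow> disjoint \<T> \<longrightarrow>
     (\<forall>T\<in>\<T>. T \<subseteq> V - Z \<and> T \<noteq> {} \<and> card T \<le> M) \<longrightarrow> q \<le> real (card Z * card \<T>) \<longrightarrow>
     (\<exists>x\<in>Z. \<exists>T\<in>\<T>. nbhd E x \<inter> T = {}))"

lemma scatteredD:
  assumes "scattered V E M q" "Z \<subseteq> V" "disjoint \<T>"
    "\<forall>T\<in>\<T>. T \<subseteq> V - Z \<and> T \<noteq> {} \<and> card T \<le> M" "q \<le> real (card Z * card \<T>)"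
  shows "\<exists>x\<in>Z. \<exists>T\<in>\<T>. nbhd E x \<inter> T = {}"
  using assms unfolding scattered_def by simp

text \<open>A family is coded by the function sending a vertex to the minimum of its member, or to
  \<open>n\<close> if it has none. The members are then the nonempty fibres over values below
  \<open>n\<close>.\<close>

lemma card_disjoint_families:
  fixes n :: nat
  defines "\<F> \<equiv> {\<T>. disjoint \<T> \<and> (\<forall>T\<in>\<T>. T \<subseteq> {..<n} \<and> T \<noteq> {})}"
  shows "finite \<F>" "card \<F> \<le> (n + 1) ^ n"
proof -
  define \<Phi> where "\<Phi> g = {{x \<in> {..<n}. g x = j} | j. j < n} - {{}}" for g :: "nat \<Rightarrow> nat"
  have sub: "\<F> \<subseteq> \<Phi> ` ({..<n} \<rightarrow>\<^sub>E {..n})"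
  proof
    fix \<T> assume "\<T> \<in> \<F>"
    then have dis: "disjoint \<T>" and T: "\<And>T. T \<in> \<T> \<Longrightarrow> T \<subseteq> {..<n} \<and> T \<noteq> {}"
      by (auto simp: \<F>_def)
    have Min: "Min T \<in> T" if "T \<in> \<T>" for T
      using T[OF that] by (intro Min_in) (auto intro: finite_subset)
    have uniq: "T = T'" if "T \<in> \<T>" "T' \<in> \<T>" "x \<in> T" "x \<in> T'" for T T' x
      using dis that by (auto simp: disjoint_def)
    define g where "g = (\<lambda>x\<in>{..<n}. if x \<in> \<Union>\<T> then Min (THE T. T \<in> \<T> \<and> x \<in> T) else n)"
    have g1: "g x = Min T" if "T \<in> \<T>" "x \<in> T" for x T
    proof -
      have "(THE T. T \<in> \<T> \<and> x \<in> T) = T"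
        using that uniq by (intro the_equality) auto
      then show ?thesis using that T[OF that(1)] by (auto simp: g_def)
    qed
    have g2: "g x = n" if "x < n" "x \<notin> \<Union>\<T>" for x using that by (auto simp: g_def)
    have less: "Min T < n" if "T \<in> \<T>" for T using Min[OF that] T[OF that] by auto
    have fibre: "{x \<in> {..<n}. g x = Min T} = T" if "T \<in> \<T>" for T
    proof (intro set_eqI iffI)
      fix x assume x: "x \<in> {x \<in> {..<n}. g x = Min T}"
      with g2[of x] less[OF that] obtain T' where T': "T' \<in> \<T>" "x \<in> T'" by fastforce
      with x g1 have "Min T' = Min T" by auto
      then have "T' = T" using Min[OF that] Min[OF T'(1)] uniq[OF T'(1) that] by metis
      with T' show "x \<in> T" by simp
    next
      fix x assume "x \<in> T"
      with that T[OF that] g1 show "x \<in> {x \<in> {..<n}. g x = Min T}" by auto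
    qed
    have "\<T> = \<Phi> g"
    proof (intro set_eqI iffI)
      fix T assume "T \<in> \<T>"
      then show "T \<in> \<Phi> g" using fibre[of T] less[of T] T[of T] unfolding \<Phi>_def by blast
    next
      fix T assume "T \<in> \<Phi> g"
      then obtain j where j: "j < n" "T = {x \<in> {..<n}. g x = j}" "T \<noteq> {}" by (auto simp: \<Phi>_def)
      then obtain x where x: "x < n" "g x = j" by auto
      with g2[of x] j obtain T' where T': "T' \<in> \<T>" "x \<in> T'" by fastforce
      then have "j = Min T'" using g1 x by auto
      then show "T \<in> \<T>" using fibre[OF T'(1)] T' j by simp
    qed
    moreover have "g \<in> {..<n} \<rightarrow>\<^sub>E {..n}"
    proof (rule PiE_I)
      fix x assume "x \<in> {..<n}"
      then show "g x \<in> {..n}" using g1[of _ x] g2[of x] less by (cases "x \<in> \<Union>\<T>") (auto intro: less_imp_le)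
    qed (simp add: g_def)
    ultimately show "\<T> \<in> \<Phi> ` ({..<n} \<rightarrow>\<^sub>E {..n})" by blast
  qed
  have fin: "finite ({..<n} \<rightarrow>\<^sub>E {..n})" by (intro finite_PiE) auto
  show "finite \<F>" using sub fin finite_subset by blast
  have "card \<F> \<le> card ({..<n} \<rightarrow>\<^sub>E {..n})"
    using sub fin surj_card_le by blast
  also have "\<dots> = (n + 1) ^ n" by (simp add: card_PiE)
  finally show "card \<F> \<le> (n + 1) ^ n" .
qed

text \<open>For fixed \<open>Z\<close> and family, the events that \<open>x\<close> has a neighbour
  in \<open>T\<close> concern disjoint edge sets: members avoid \<open>Z\<close>, so an edge reveals
  which end is in \<open>Z\<close> and which member holds the other. A union bound over all choices
  follows.\<close>

lemma prob_not_scattered: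
  assumes p: "0 < p" "p < 1" and M: "0 < M"
  shows "measure_pmf.prob (random_graph n p) {E. \<not> scattered {..<n} E M q}
    \<le> 2 ^ n * real (n + 1) ^ n * (1 - min p (1 - p) ^ M) powr q"
proof -
  let ?P = "measure_pmf.prob (random_graph n p)"
  let ?b = "1 - min p (1 - p) ^ M"
  define \<F> where "\<F> = {\<T>. disjoint \<T> \<and> (\<forall>T\<in>\<T>. T \<subseteq> {..<n} \<and> T \<noteq> {})}"
  define I where "I = {(Z, \<T>) \<in> Pow {..<n} \<times> \<F>. q \<le> real (card Z * card \<T>) \<and>
    (\<forall>T\<in>\<T>. T \<subseteq> {..<n} - Z \<and> T \<noteq> {} \<and> card T \<le> M)}"
  define A where "A = (\<lambda>(Z, \<T>). {E. \<forall>j\<in>Z \<times> \<T>. \<exists>e\<in>(\<lambda>(x, T). (\<lambda>y. {x, y}) ` T) j. (e \<in> E) \<noteq> False} :: nat set set set)"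
  have F: "finite \<F>" "card \<F> \<le> (n + 1) ^ n" unfolding \<F>_def by (rule card_disjoint_families)+
  have sub: "I \<subseteq> Pow {..<n} \<times> \<F>" by (auto simp: I_def)
  then have fin: "finite I" using F finite_subset by blast
  have "card I \<le> card (Pow {..<n} \<times> \<F>)" using sub F by (intro card_mono) auto
  also have "\<dots> = 2 ^ n * card \<F>" by (simp add: card_cartesian_product card_Pow)
  also have "\<dots> \<le> 2 ^ n * (n + 1) ^ n" using F by (intro mult_left_mono) auto
  finally have "real (card I) \<le> real (2 ^ n * (n + 1) ^ n)" by (rule of_nat_mono)
  then have cI: "real (card I) \<le> 2 ^ n * real (n + 1) ^ n" by simp
  have b: "0 \<le> ?b" "?b < 1" using p by (auto simp: power_le_one)
  have b0: "0 < ?b" using b p M by (simp add: power_less_one_iff min_less_iff_disj)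
  have "{E. \<not> scattered {..<n} E M q} \<subseteq> (\<Union>i\<in>I. A i)"
  proof
    fix E assume "E \<in> {E. \<not> scattered {..<n} E M q}"
    then obtain Z \<T> where *: "Z \<subseteq> {..<n}" "disjoint \<T>" "\<forall>T\<in>\<T>. T \<subseteq> {..<n} - Z \<and> T \<noteq> {} \<and> card T \<le> M"
      "q \<le> real (card Z * card \<T>)" "\<forall>x\<in>Z. \<forall>T\<in>\<T>. nbhd E x \<inter> T \<noteq> {}"
      by (auto simp: scattered_def)
    have "(Z, \<T>) \<in> I" using * by (auto simp: I_def \<F>_def)
    moreover have "E \<in> A (Z, \<T>)" using *(5) by (fastforce simp: A_def nbhd_def)
    ultimately show "E \<in> (\<Union>i\<in>I. A i)" by blast
  qed
  then have "?P {E. \<not> scattered {..<n} E M q} \<le> ?P (\<Union>i\<in>I. A i)"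
    by (intro measure_pmf.finite_measure_mono) auto
  also have "\<dots> \<le> (\<Sum>i\<in>I. ?P (A i))"
    using fin by (intro measure_pmf.finite_measure_subadditive_finite) auto
  also have "\<dots> \<le> (\<Sum>i\<in>I. ?b powr q)"
  proof (rule sum_mono)
    fix i assume i: "i \<in> I"
    obtain Z \<T> where [simp]: "i = (Z, \<T>)" by (cases i)
    from i have Z: "Z \<subseteq> {..<n}" "disjoint \<T>" "q \<le> real (card Z * card \<T>)"
      and T: "\<And>T. T \<in> \<T> \<Longrightarrow> T \<subseteq> {..<n} - Z \<and> T \<noteq> {} \<and> card T \<le> M"
      by (auto simp: I_def \<F>_def)
    have finT: "finite T" if "T \<in> \<T>" for T using T[OF that] finite_subset by blast
    have "\<T> \<subseteq> Pow {..<n}" using T by auto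
    then have "finite \<T>" by (rule finite_subset) simp
    moreover have "finite Z" using Z(1) by (rule finite_subset) simp
    ultimately have "finite (Z \<times> \<T>)" by simp
    then have "?P {E. \<forall>j\<in>Z \<times> \<T>. \<exists>e\<in>(\<lambda>(x, T). (\<lambda>y. {x, y}) ` T) j. (e \<in> E) \<noteq> False} \<le> ?b ^ card (Z \<times> \<T>)"
    proof (rule random_graph_disjoint_patterns_le[OF _ p])
      fix j assume "j \<in> Z \<times> \<T>"
      then obtain x T where j: "j = (x, T)" "x \<in> Z" "T \<in> \<T>" by auto
      show "(\<lambda>(x, T). (\<lambda>y. {x, y}) ` T) j \<subseteq> [{..<n}]\<^bsup>2\<^esup>"
        using j Z(1) T[of T] by auto
      show "card ((\<lambda>(x, T). (\<lambda>y. {x, y}) ` T) j) \<le> M"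
        using j T[of T] finT[of T] card_image_le[of T "\<lambda>y. {x, y}"] by simp
    next
      show "disjoint_family_on (\<lambda>(x, T). (\<lambda>y. {x, y}) ` T) (Z \<times> \<T>)"
        unfolding disjoint_family_on_def
      proof (intro ballI impI)
        fix j j' assume "j \<in> Z \<times> \<T>" "j' \<in> Z \<times> \<T>" "j \<noteq> j'"
        then obtain x T x' T' where j: "j = (x, T)" "x \<in> Z" "T \<in> \<T>" "j' = (x', T')" "x' \<in> Z" "T' \<in> \<T>" "x \<noteq> x' \<or> T \<noteq> T'"
          by auto
        have "False" if "y \<in> T" "y' \<in> T'" "{x, y} = {x', y'}" for y y'
        proof -
          have "y \<notin> Z" "y' \<notin> Z" using T j that by blast+
          then have "x = x'" "y = y'" using that j by (auto simp: doubleton_eq_iff)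
          then show False using j that Z(2) by (auto simp: disjoint_def)
        qed
        then show "(\<lambda>(x, T). (\<lambda>y. {x, y}) ` T) j \<inter> (\<lambda>(x, T). (\<lambda>y. {x, y}) ` T) j' = {}"
          using j by auto
      qed
    qed
    then have "?P (A i) \<le> ?b ^ (card Z * card \<T>)" by (simp add: A_def card_cartesian_product)
    also have "?b ^ (card Z * card \<T>) = ?b powr real (card Z * card \<T>)"
      using b0 by (rule powr_realpow [symmetric])
    also have "\<dots> \<le> ?b powr q"
      using b Z by (intro powr_mono') auto
    finally show "?P (A i) \<le> ?b powr q" .
  qed
  also have "\<dots> = real (card I) * ?b powr q" by simp
  also have "\<dots> \<le> (2 ^ n * real (n + 1) ^ n) * ?b powr q"
    using cI by (intro mult_right_mono) auto
  finally show ?thesis .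
qed

definition private_nbrs :: "'a set \<Rightarrow> 'a set set \<Rightarrow> nat \<Rightarrow> bool" where
  "private_nbrs V E t \<longleftrightarrow> (\<forall>v\<in>V. \<forall>w\<in>V - {v}. \<forall>w'\<in>V - {v}. t \<le> card (nbhd E v - nbhd E w - nbhd E w' - {w, w'}))"

text \<open>
  For the union bound, \<open>t\<close> neighbours are found by splitting the vertices into \<open>t\<close> chunks of size \<open>s\<close>, each of which contains one.
\<close>

lemma prob_not_private_nbrs:
  assumes p: "0 < p" "p < 1" and ts: "t * s \<le> n"
  shows "measure_pmf.prob (random_graph n p) {E. \<not> private_nbrs {..<n} E t}
    \<le> real n ^ 3 * real t * (1 - min p (1 - p) ^ 3) ^ (s - 3)"
proof -
  let ?P = "measure_pmf.prob (random_graph n p)"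
  let ?b = "1 - min p (1 - p) ^ 3"
  define D where "D i = {i * s..<Suc i * s}" for i
  define I where "I = {(v, w, w', i). v < n \<and> w < n \<and> w' < n \<and> i < t \<and> w \<noteq> v \<and> w' \<noteq> v}"
  \<comment> \<open>The wanted pattern joins \<open>x\<close> to \<open>v\<close> but not to
    \<open>w\<close> or \<open>w'\<close>. Since these and \<open>x\<close> differ from
    \<open>v\<close>, the test \<open>v \<in> e\<close> encodes it.\<close>
  define A where "A = (\<lambda>(v, w, w', i). {E. \<forall>x\<in>D i - {v, w, w'}. \<exists>e\<in>{{v, x}, {w, x}, {w', x}}. (e \<in> E) \<noteq> (v \<in> e)})"
  have sub: "I \<subseteq> {..<n} \<times> {..<n} \<times> {..<n} \<times> {..<t}" by (auto simp: I_def)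
  then have fin: "finite I" using finite_subset by blast
  have "card I \<le> card ({..<n} \<times> {..<n} \<times> {..<n} \<times> {..<t})" using sub by (intro card_mono) auto
  also have "\<dots> = n ^ 3 * t" by (simp add: card_cartesian_product power3_eq_cube)
  finally have "real (card I) \<le> real (n ^ 3 * t)" by (rule of_nat_mono)
  then have cI: "real (card I) \<le> real n ^ 3 * real t" by simp
  have b: "0 \<le> ?b" "?b \<le> 1" using p by (auto simp: power_le_one)
  have D: "D i \<subseteq> {..<n}" if "i < t" for i
  proof -
    have "Suc i * s \<le> t * s" using that by (intro mult_right_mono) auto
    then show ?thesis using ts by (auto simp: D_def)
  qed
  have Ddisj: "i = j" if "x \<in> D i" "x \<in> D j" for x i j
  proof -
    have "x div s = i" if "x \<in> D i" for i using that by (intro div_nat_eqI) (auto simp: D_def mult.commute)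
    then show ?thesis using that by blast
  qed
  have cD: "card (D i) = s" for i by (simp add: D_def)
  have "{E. \<not> private_nbrs {..<n} E t} \<inter> set_pmf (random_graph n p) \<subseteq> (\<Union>i\<in>I. A i)"
  proof
    fix E assume "E \<in> {E. \<not> private_nbrs {..<n} E t} \<inter> set_pmf (random_graph n p)"
    then obtain v w w' where *: "v < n" "w < n" "w' < n" "w \<noteq> v" "w' \<noteq> v"
      "\<not> t \<le> card (nbhd E v - nbhd E w - nbhd E w' - {w, w'})" and E: "E \<subseteq> [{..<n}]\<^bsup>2\<^esup>"
      by (auto simp: private_nbrs_def random_graph_def)
    let ?R = "nbhd E v - nbhd E w - nbhd E w' - {w, w'}"
    have "\<exists>i<t. ?R \<inter> (D i - {v, w, w'}) = {}"
    proof (rule ccontr)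
      assume "\<not> ?thesis"
      then have "\<forall>i\<in>{..<t}. \<exists>x. x \<in> ?R \<inter> D i" by blast
      then obtain x where x: "\<And>i. i < t \<Longrightarrow> x i \<in> ?R \<inter> D i" by (metis lessThan_iff)
      have "inj_on x {..<t}"
      proof (rule inj_onI)
        fix i j assume "i \<in> {..<t}" "j \<in> {..<t}" "x i = x j"
        then show "i = j" using x[of i] x[of j] Ddisj[of "x i" i j] by simp
      qed
      moreover have "x ` {..<t} \<subseteq> ?R" using x by auto
      moreover have "finite ?R" using E by (auto simp: nbhd_def intro!: finite_subset[of _ "{..<n}"])
      ultimately show False using * card_inj_on_le[of x "{..<t}" ?R] by auto
    qed
    then obtain i where i: "i < t" "?R \<inter> (D i - {v, w, w'}) = {}" by blast
    have "E \<in> A (v, w, w', i)"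
      using i(2) *(4,5) by (fastforce simp: A_def nbhd_def)
    moreover have "(v, w, w', i) \<in> I" using * i by (auto simp: I_def)
    ultimately show "E \<in> (\<Union>i\<in>I. A i)" by blast
  qed
  then have "?P {E. \<not> private_nbrs {..<n} E t} \<le> ?P (\<Union>i\<in>I. A i)"
    by (subst measure_Int_set_pmf [symmetric]) (intro measure_pmf.finite_measure_mono, auto)
  also have "\<dots> \<le> (\<Sum>i\<in>I. ?P (A i))"
    using fin by (intro measure_pmf.finite_measure_subadditive_finite) auto
  also have "\<dots> \<le> (\<Sum>i\<in>I. ?b ^ (s - 3))"
  proof (rule sum_mono)
    fix y assume y: "y \<in> I"
    obtain v w w' i where [simp]: "y = (v, w, w', i)" by (metis prod_cases4)
    from y have *: "v < n" "w < n" "w' < n" "i < t" "w \<noteq> v" "w' \<noteq> v" by (auto simp: I_def)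
    let ?J = "D i - {v, w, w'}"
    have "?P (A y) \<le> ?b ^ card ?J"
      unfolding A_def \<open>y = (v, w, w', i)\<close> prod.case
    proof (rule random_graph_disjoint_patterns_le[OF _ p])
      show "disjoint_family_on (\<lambda>x. {{v, x}, {w, x}, {w', x}}) ?J"
        by (auto simp: disjoint_family_on_def doubleton_eq_iff)
      show "card {{v, x}, {w, x}, {w', x}} \<le> 3" for x
        by (simp add: card_insert_if)
      show "{{v, x}, {w, x}, {w', x}} \<subseteq> [{..<n}]\<^bsup>2\<^esup>" if "x \<in> ?J" for x
        using that * D[of i] by auto
      show "finite ?J" by (simp add: D_def)
    qed
    also have "\<dots> \<le> ?b ^ (s - 3)"
    proof (rule power_decreasing)
      have "card {v, w, w'} \<le> 3" by (simp add: card_insert_if)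
      then have "s - 3 \<le> card (D i) - card {v, w, w'}" using cD[of i] by simp
      also have "\<dots> \<le> card ?J" by (rule diff_card_le_card_Diff) auto
      finally show "s - 3 \<le> card ?J" .
    qed (use b in auto)
    finally show "?P (A y) \<le> ?b ^ (s - 3)" .
  qed
  also have "\<dots> = real (card I) * ?b ^ (s - 3)" by simp
  also have "\<dots> \<le> (real n ^ 3 * real t) * ?b ^ (s - 3)"
    using cI b by (intro mult_right_mono) auto
  finally show ?thesis .
qed

section \<open>Asymptotics\<close>

context fin_graph
begin

text \<open>Given \<open>z\<close> low vertices, discard the palette colours missed by one of them,
  used on one of them, or with more than \<open>M\<close> bearers. The remaining classes are small,
  disjoint, away from \<open>Z\<close>, and seen from all of \<open>Z\<close>, against
  \<open>scattered\<close>.\<close>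

lemma few_low_if_scattered:
  assumes sc: "scattered V E M q" and f: "dom f \<subseteq> V" and M: "0 < M" and z: "0 < z"
    and q: "q \<le> real z * real (K - (z * \<tau> + z + card V div M))"
  shows "card {v \<in> V. card ({1..K} - {c. \<exists>x\<in>nbhd E v. f x = Some c}) < \<tau>} \<le> z"
proof (rule ccontr)
  define seen where "seen v = {c. \<exists>x\<in>nbhd E v. f x = Some c}" for v
  assume "\<not> ?thesis"
  then obtain Z where Z: "Z \<subseteq> {v \<in> V. card ({1..K} - seen v) < \<tau>}" "card Z = z"
    unfolding seen_def by (metis (no_types, lifting) nat_le_linear obtain_subset_with_card_n)
  have ZV: "Z \<subseteq> V" and finZ: "finite Z" and Zne: "Z \<noteq> {}" using Z z card_gt_0_iff[of Z] by auto
  define T where "T c = {x \<in> V. f x = Some c}" for c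
  define Miss where "Miss = (\<Union>v\<in>Z. {1..K} - seen v)"
  define Hit where "Hit = the ` f ` Z"
  define Big where "Big = {c \<in> {1..K}. M < card (T c)}"
  define J where "J = {1..K} - (Miss \<union> Hit \<union> Big)"
  have finT: "finite (T c)" for c using finV by (simp add: T_def)
  have "card Miss \<le> (\<Sum>v\<in>Z. card ({1..K} - seen v))" unfolding Miss_def by (rule card_UN_le[OF finZ])
  also have "\<dots> \<le> (\<Sum>v\<in>Z. \<tau>)" using Z(1) by (intro sum_mono) auto
  finally have miss: "card Miss \<le> z * \<tau>" using Z(2) by simp
  have hit: "card Hit \<le> z" unfolding Hit_def image_image using card_image_le[OF finZ] Z(2) by metis
  have "card Big * M = (\<Sum>c\<in>Big. M)" by simp
  also have "\<dots> \<le> (\<Sum>c\<in>Big. card (T c))" by (intro sum_mono) (simp add: Big_def)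
  also have "\<dots> = card (\<Union>c\<in>Big. T c)"
    using finT by (intro card_UN_disjoint[symmetric]) (auto simp: Big_def T_def)
  also have "\<dots> \<le> card V" using finV by (intro card_mono) (auto simp: T_def)
  finally have big: "card Big \<le> card V div M" using M by (simp add: less_eq_div_iff_mult_less_eq)
  have "finite (Miss \<union> Hit \<union> Big)" using finZ by (auto simp: Miss_def Hit_def Big_def)
  then have "card {1..K} - card (Miss \<union> Hit \<union> Big) \<le> card J" unfolding J_def by (rule diff_card_le_card_Diff)
  moreover have "card (Miss \<union> Hit \<union> Big) \<le> z * \<tau> + z + card V div M"
    using card_Un_le[of "Miss \<union> Hit" Big] card_Un_le[of Miss Hit] miss hit big by linarith
  ultimately have J: "K - (z * \<tau> + z + card V div M) \<le> card J" by simp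
  have seen: "c \<in> seen v" if "c \<in> J" "v \<in> Z" for c v using that by (auto simp: J_def Miss_def)
  have Tne: "T c \<noteq> {}" if cJ: "c \<in> J" for c
  proof -
    obtain v where "v \<in> Z" using Zne by auto
    then obtain x where "x \<in> nbhd E v" "f x = Some c" using seen[OF cJ] by (auto simp: seen_def)
    then show ?thesis using nbhd_subset[of v] by (auto simp: T_def)
  qed
  have inj: "inj_on T J"
  proof (rule inj_onI)
    fix c c' assume "c \<in> J" "c' \<in> J" "T c = T c'"
    then obtain x where "x \<in> T c" "x \<in> T c'" using Tne by blast
    then show "c = c'" by (simp add: T_def)
  qed
  have "disjoint (T ` J)" by (auto simp: disjoint_def T_def)
  moreover have "\<forall>S\<in>T ` J. S \<subseteq> V - Z \<and> S \<noteq> {} \<and> card S \<le> M"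
  proof
    fix S assume "S \<in> T ` J"
    then obtain c where c: "c \<in> J" "S = T c" by auto
    have "x \<notin> Z" if "x \<in> T c" for x
    proof
      assume "x \<in> Z"
      then have "the (f x) \<in> Hit" by (simp add: Hit_def)
      then show False using that c(1) by (simp add: T_def J_def)
    qed
    then show "S \<subseteq> V - Z \<and> S \<noteq> {} \<and> card S \<le> M"
      using c Tne[of c] by (auto simp: T_def J_def Big_def)
  qed
  moreover have "q \<le> real (card Z * card (T ` J))"
  proof -
    have "real z * real (K - (z * \<tau> + z + card V div M)) \<le> real z * real (card J)"
      using J by (intro mult_left_mono) auto
    then show ?thesis using q Z(2) by (simp add: card_image[OF inj])
  qed
  ultimately have "\<exists>v\<in>Z. \<exists>S\<in>T ` J. nbhd E v \<inter> S = {}" by (rule scatteredD[OF sc ZV])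
  then obtain v c where v: "v \<in> Z" "c \<in> J" "nbhd E v \<inter> T c = {}" by blast
  then obtain x where "x \<in> nbhd E v" "f x = Some c" using seen[of c v] by (auto simp: seen_def)
  then show False using v(3) nbhd_subset[of v] by (auto simp: T_def)
qed

text \<open>From \<open>R\<close> remove, for each of \<open>z\<close> pairs, its vertices and the
  at most \<open>s\<close> vertices adjacent to neither. Every remaining vertex has a neighbour in
  every pair.\<close>

lemma few_flagged_if_scattered:
  assumes sc: "scattered V E M q" and M: "2 \<le> M" and R: "R \<subseteq> V" "r \<le> card R" and dis: "disjoint \<T>"
    and T: "\<forall>T\<in>\<T>. \<exists>w\<in>V. \<exists>w'\<in>V. T = {w, w'} \<and> card (R - nbhd E w - nbhd E w' - {w, w'}) \<le> s"
    and q: "q \<le> real (r - z * (s + 2)) * real z"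
  shows "card \<T> < z"
proof (rule ccontr)
  assume "\<not> ?thesis"
  then obtain \<S> where S: "\<S> \<subseteq> \<T>" "card \<S> = z" "finite \<S>"
    by (meson not_less obtain_subset_with_card_n)
  define X where "X T = T \<union> {x \<in> R. x \<notin> T \<and> nbhd E x \<inter> T = {}}" for T
  define Z where "Z = R - (\<Union>T\<in>\<S>. X T)"
  have finR: "finite R" using R finV finite_subset by auto
  have S2: "T \<subseteq> V \<and> T \<noteq> {} \<and> card T \<le> 2 \<and> card (X T) \<le> s + 2 \<and> finite (X T)" if TS: "T \<in> \<S>" for T
  proof -
    obtain w w' where w: "w \<in> V" "w' \<in> V" "T = {w, w'}" "card (R - nbhd E w - nbhd E w' - {w, w'}) \<le> s"
      using TS S(1) T by blast
    have "nbhd E x \<inter> T = {} \<longleftrightarrow> x \<notin> nbhd E w \<and> x \<notin> nbhd E w'" for x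
      using w(3) nbhd_sym[of x w] nbhd_sym[of x w'] by auto
    then have "{x \<in> R. x \<notin> T \<and> nbhd E x \<inter> T = {}} = R - nbhd E w - nbhd E w' - {w, w'}"
      using w(3) by auto
    moreover have "card T \<le> 2" using w(3) by (simp add: card_insert_if)
    ultimately show ?thesis
      using w card_Un_le[of T "{x \<in> R. x \<notin> T \<and> nbhd E x \<inter> T = {}}"] finR by (auto simp: X_def)
  qed
  have "card (\<Union>T\<in>\<S>. X T) \<le> (\<Sum>T\<in>\<S>. card (X T))" by (rule card_UN_le[OF S(3)])
  also have "\<dots> \<le> (\<Sum>T\<in>\<S>. s + 2)" using S2 by (intro sum_mono) auto
  finally have "card (\<Union>T\<in>\<S>. X T) \<le> z * (s + 2)" using S(2) by simp
  moreover have "card R - card (\<Union>T\<in>\<S>. X T) \<le> card Z"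
    unfolding Z_def using S2 S(3) by (intro diff_card_le_card_Diff) auto
  ultimately have "r - z * (s + 2) \<le> card Z" using R(2) by linarith
  then have "real (r - z * (s + 2)) * real z \<le> real (card Z) * real z" by (intro mult_right_mono) auto
  then have qq: "q \<le> real (card Z * card \<S>)" using q S(2) by simp
  have "disjoint \<S>" using dis S(1) by (auto simp: disjoint_def)
  moreover have "\<forall>T\<in>\<S>. T \<subseteq> V - Z \<and> T \<noteq> {} \<and> card T \<le> M"
  proof
    fix T assume "T \<in> \<S>"
    then show "T \<subseteq> V - Z \<and> T \<noteq> {} \<and> card T \<le> M" using S2[of T] M by (auto simp: Z_def X_def)
  qed
  moreover have "Z \<subseteq> V" using R by (auto simp: Z_def)
  ultimately have "\<exists>x\<in>Z. \<exists>T\<in>\<S>. nbhd E x \<inter> T = {}" using scatteredD[OF sc] qq by simp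
  then show False by (auto simp: Z_def X_def)
qed

end

text \<open>Take logarithms and compare with second-order bounds for \<open>ln (1 + l)\<close> and
  \<open>ln (1 - l)\<close>. The linear terms give \<open>b - a\<close>; the quadratic ones cost
  \<open>2 * l * d\<close>, so \<open>l\<close> should be small, but \<open>ln x / l\<close> keeps
  it from vanishing too fast.\<close>

lemma balanced_share:
  fixes l d x :: real and a b w :: nat
  assumes l: "0 < l" "l \<le> 1 / 2" and x: "0 < x"
    and le: "(1 + l) ^ b * (1 - l) ^ a \<le> x * (1 + l) ^ (w + 1)" and d: "real a + real b \<le> d"
  shows "2 * real b \<le> d + 2 * l * d + ln x / l + real w + 1"
proof -
  have "ln ((1 + l) ^ b * (1 - l) ^ a) \<le> ln (x * (1 + l) ^ (w + 1))"
    using le l x by simp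
  then have ln: "real b * ln (1 + l) + real a * ln (1 - l) \<le> ln x + real (w + 1) * ln (1 + l)"
    using l x by (simp add: ln_mult ln_realpow del: power_Suc)
  have "real b * (l - l\<^sup>2) \<le> real b * ln (1 + l)"
    using l by (intro mult_left_mono ln_one_plus_pos_lower_bound) auto
  moreover have "real a * (- l - 2 * l\<^sup>2) \<le> real a * ln (1 - l)"
    using l by (intro mult_left_mono ln_one_minus_pos_lower_bound) auto
  moreover have "real (w + 1) * ln (1 + l) \<le> real (w + 1) * l"
    using l ln_add_one_self_le_self[of l] by (intro mult_left_mono) auto
  ultimately have "real b * (l - l\<^sup>2) - real a * (l + 2 * l\<^sup>2) \<le> ln x + real (w + 1) * l"
    using ln by (simp add: algebra_simps)
  then have "l * (real b - real a) \<le> l\<^sup>2 * (real b + 2 * real a) + ln x + real (w + 1) * l"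
    by (simp add: algebra_simps)
  also have "\<dots> \<le> l\<^sup>2 * (2 * d) + ln x + real (w + 1) * l"
    using d by (intro add_right_mono mult_left_mono) auto
  finally have "real b - real a \<le> (l\<^sup>2 * (2 * d) + ln x + real (w + 1) * l) / l"
    using l by (simp add: le_divide_eq mult.commute)
  also have "\<dots> = 2 * l * d + ln x / l + real w + 1"
    using l by (simp add: field_simps power2_eq_square)
  finally show ?thesis using d by linarith
qed

definition cbrt :: "nat \<Rightarrow> nat" where
  "cbrt n = nat \<lceil>real n powr (1 / 3)\<rceil>"

lemma nat_ceiling_bounds: "0 \<le> x \<Longrightarrow> x \<le> real (nat \<lceil>x\<rceil>)" "0 \<le> x \<Longrightarrow> real (nat \<lceil>x\<rceil>) \<le> x + 1"
  by linarith+

lemma nat_floor_bounds: "0 \<le> x \<Longrightarrow> real (nat \<lfloor>x\<rfloor>) \<le> x" "0 \<le> x \<Longrightarrow> x - 1 \<le> real (nat \<lfloor>x\<rfloor>)"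
  by linarith+

text \<open>With \<open>l = \<delta>\<close>, the colours beyond \<open>p * n / 2\<close> are
  budgeted in units of \<open>\<delta> * n\<close>: 2 for Bob's share (excess degree and quadratic
  error), 1 for the palette and 4 for lower-order terms, out of 8.\<close>

lemma eventually_upper:
  fixes p \<delta> \<epsilon> :: real
  assumes p: "0 < p" "p < 1" and \<delta>: "0 < \<delta>" "\<delta> \<le> 1 / 2" "8 * \<delta> \<le> \<epsilon>" and M: "4 / \<delta> \<le> real M"
  shows "\<forall>\<^sub>F n in sequentially. \<forall>E. E \<subseteq> [{..<n}]\<^bsup>2\<^esup> \<longrightarrow>
    (\<forall>v<n. real (card (nbhd E v)) \<le> (p + \<delta>) * real n) \<longrightarrow> scattered {..<n} E M (real n powr (5 / 4)) \<longrightarrow>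
    (\<exists>\<sigma>. winning_strategy {..<n} E (nat \<lfloor>(p / 2 + \<epsilon>) * real n\<rfloor>) \<sigma>)"
proof -
  define W where "W x = (x powr (1/3) + 1) * (x / (x powr (1/2) / 4 - 1) + 1)" for x :: real
  have "\<forall>\<^sub>F n in sequentially. 2 \<le> 7 * \<delta> * real n" using \<delta> by real_asymp
  moreover have "\<forall>\<^sub>F n in sequentially. real n powr (1/2) + 1 \<le> \<delta> * real n" using \<delta> by real_asymp
  moreover have "\<forall>\<^sub>F n in sequentially. 2 * (real n powr (1/3) + 1) + 1 < real n powr (1/2) / 4 - 1" by real_asymp
  moreover have "\<forall>\<^sub>F n in sequentially. 2 * (real n powr (1/3) + 1) + 4 + real n powr (1/2) / 4 \<le> real n powr (1/2)" by real_asymp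
  moreover have "\<forall>\<^sub>F n in sequentially. real n powr (5/4) \<le> real n powr (1/3) * (\<delta> * real n -
      ((real n powr (1/3) + 1) * (real n powr (1/2) + 1) + (real n powr (1/3) + 1) + \<delta> * real n / 4))"
    using \<delta> by real_asymp
  \<comment> \<open>\<open>W\<close> bounds the forced moves of a round. It counts once for colours
    outside the palette and half for Bob's share; 6 is the 4 in \<open>A\<close> plus two rounding
    errors.\<close>
  moreover have "\<forall>\<^sub>F n in sequentially. 3 / 2 * W (real n) + 1 / 2 + ln (real n) / (2 * \<delta>) + 2 * (real n powr (1/3) + 1) + 6 \<le> 4 * \<delta> * real n"
    unfolding W_def using \<delta> by real_asymp
  ultimately show ?thesis using eventually_gt_at_top[of 0]
  proof eventually_elim
    case (elim n)
    let ?x = "real n"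
    let ?V = "{..<n}"
    define z where "z = cbrt n"
    define \<tau> where "\<tau> = nat \<lceil>?x powr (1/2)\<rceil>"
    define Ep where "Ep = nat \<lfloor>?x powr (1/2) / 4\<rfloor>"
    define K where "K = nat \<lceil>\<delta> * ?x\<rceil>"
    define k where "k = nat \<lfloor>(p / 2 + \<epsilon>) * ?x\<rfloor>"
    have x: "0 < ?x" using elim by simp
    have z: "?x powr (1/3) \<le> real z" "real z \<le> ?x powr (1/3) + 1"
      unfolding z_def cbrt_def by (rule nat_ceiling_bounds; simp)+
    have \<tau>: "?x powr (1/2) \<le> real \<tau>" "real \<tau> \<le> ?x powr (1/2) + 1"
      unfolding \<tau>_def by (rule nat_ceiling_bounds; simp)+
    have Ep: "real Ep \<le> ?x powr (1/2) / 4" "?x powr (1/2) / 4 - 1 \<le> real Ep"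
      unfolding Ep_def by (rule nat_floor_bounds; simp)+
    have K: "\<delta> * ?x \<le> real K" "real K \<le> \<delta> * ?x + 1"
      unfolding K_def using \<delta> x by (auto intro!: nat_ceiling_bounds)
    have "0 \<le> (p / 2 + \<epsilon>) * ?x" using p \<delta> x by simp
    then have k: "(p / 2 + \<epsilon>) * ?x - 1 \<le> real k"
      unfolding k_def by (rule nat_floor_bounds)
    have \<epsilon>x: "p / 2 * ?x + 8 * \<delta> * ?x \<le> (p / 2 + \<epsilon>) * ?x"
      using \<delta>(3) x by (simp add: algebra_simps)
    have px: "0 < p / 2 * ?x" "0 < \<delta> * ?x" using p \<delta> x by simp_all
    have z0: "0 < z"
    proof -
      have "0 < ?x powr (1/3)" using x by simp
      then show ?thesis using z(1) by linarith
    qed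
    have M0: "0 < M" using M \<delta> by (metis divide_pos_pos less_le_trans of_nat_0_less_iff zero_less_numeral)
    show ?case
    proof (intro allI impI)
      fix E assume E: "E \<subseteq> [?V]\<^bsup>2\<^esup>" and deg: "\<forall>v<n. real (card (nbhd E v)) \<le> (p + \<delta>) * ?x"
        and sc: "scattered ?V E M (?x powr (5/4))"
      interpret fin_graph ?V E by unfold_locales (simp, rule E)
      interpret upper_game ?V E k K "2 * z + 4" \<tau> Ep z \<delta>
      proof unfold_locales
        show "?V \<noteq> {}" using elim by auto
        show "K \<le> k"
        proof -
          have "real K \<le> real k" using K(2) k elim(1) \<epsilon>x px by linarith
          then show ?thesis by simp
        qed
        show "\<tau> \<le> K"
        proof -
          have "real \<tau> \<le> real K" using \<tau>(2) elim(2) K(1) by linarith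
          then show ?thesis by simp
        qed
        show "0 < \<delta>" "\<delta> < 1" using \<delta> by auto
        show "2 * z + 4 \<le> 2 * z + 4" by simp
        show "2 * z + 1 < Ep"
        proof -
          have "real (2 * z + 1) < real Ep" using z(2) elim(3) Ep(2) by simp
          then show ?thesis by (simp only: of_nat_less_iff)
        qed
        show "2 * z + 4 + Ep \<le> \<tau>"
        proof -
          have "real (2 * z + 4 + Ep) \<le> real \<tau>" using z(2) elim(4) Ep(1) \<tau>(1) by simp
          then show ?thesis by (simp only: of_nat_le_iff)
        qed
      next
        fix f :: "nat \<Rightarrow> nat option" assume f: "dom f \<subseteq> ?V"
        show "card {v \<in> ?V. card ({1..K} - {c. \<exists>x\<in>nbhd E v. f x = Some c}) < \<tau>} \<le> z"
        proof (rule few_low_if_scattered[OF sc f M0 z0])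
          let ?y = "(?x powr (1/3) + 1) * (?x powr (1/2) + 1) + (?x powr (1/3) + 1) + \<delta> * ?x / 4"
          have "real (n div M) \<le> ?x / real M" by (rule of_nat_div_le_of_nat)
          also have "\<dots> \<le> \<delta> * ?x / 4"
            using M M0 \<delta> x by (simp add: field_simps)
          finally have div: "real (n div M) \<le> \<delta> * ?x / 4" .
          have "real z * real \<tau> \<le> (?x powr (1/3) + 1) * (?x powr (1/2) + 1)"
            using z \<tau> by (intro mult_mono) auto
          then have "real (z * \<tau> + z + n div M) \<le> ?y" using z(2) div by simp
          then have "\<delta> * ?x - ?y \<le> real (K - (z * \<tau> + z + n div M))" using K(1) by linarith
          then have "?x powr (1/3) * (\<delta> * ?x - ?y) \<le> ?x powr (1/3) * real (K - (z * \<tau> + z + n div M))"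
            by (intro mult_left_mono) auto
          also have "\<dots> \<le> real z * real (K - (z * \<tau> + z + n div M))"
            using z(1) by (intro mult_right_mono) auto
          finally show "?x powr (5/4) \<le> real z * real (K - (z * \<tau> + z + card ?V div M))"
            using elim(5) by simp
        qed
      next
        fix v a b w :: nat
        assume v: "v \<in> ?V" and ab: "a + b = card (nbhd E v)" and w: "w \<le> z * (card ?V div Ep + 1)"
          and pot: "(1 + \<delta>) ^ b * (1 - \<delta>) ^ a \<le> real (card ?V) * (1 + \<delta>) ^ (w + 1)"
        have d: "real a + real b \<le> (p + \<delta>) * ?x" using deg v ab by (metis lessThan_iff of_nat_add)
        have "2 * real b \<le> (p + \<delta>) * ?x + 2 * \<delta> * ((p + \<delta>) * ?x) + ln ?x / \<delta> + real w + 1"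
          using balanced_share[OF \<delta>(1,2) x _ d, of w] pot by simp
        moreover have "2 * \<delta> * ((p + \<delta>) * ?x) \<le> 2 * \<delta> * (3 / 2 * ?x)"
          using p \<delta> x by (intro mult_left_mono mult_right_mono) auto
        ultimately have b: "real b \<le> p / 2 * ?x + 2 * \<delta> * ?x + ln ?x / (2 * \<delta>) + real w / 2 + 1 / 2"
          using \<delta> by (simp add: algebra_simps)
        have Epos: "0 < ?x powr (1/2) / 4 - 1"
        proof -
          have "0 < 2 * (u + 1) + 1" if "0 \<le> u" for u :: real using that by simp
          then have "0 < 2 * (?x powr (1/3) + 1) + 1" using powr_ge_zero by blast
          also note elim(3)
          finally show ?thesis .
        qed
        have "real (n div Ep) \<le> ?x / real Ep" by (rule of_nat_div_le_of_nat)
        also have "\<dots> \<le> ?x / (?x powr (1/2) / 4 - 1)"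
          using Ep(2) Epos x by (intro divide_left_mono mult_pos_pos) auto
        finally have "real z * (real (n div Ep) + 1) \<le> W ?x"
          unfolding W_def using z by (intro mult_mono) auto
        moreover have "real w \<le> real z * (real (n div Ep) + 1)"
          using of_nat_mono[OF w, where ?'a = real] by (simp only: of_nat_mult of_nat_add of_nat_1 card_lessThan)
        ultimately have w: "real w \<le> W ?x" by linarith
        have "real b + real K + real w + real (2 * z + 4) \<le> real k"
          using b w K(2) z(2) elim(6) k \<epsilon>x px by simp
        then show "b + K + w + (2 * z + 4) \<le> k" by (simp only: of_nat_add [symmetric] of_nat_le_iff)
      qed
      show "\<exists>\<sigma>. winning_strategy ?V E (nat \<lfloor>(p / 2 + \<epsilon>) * ?x\<rfloor>) \<sigma>"
        using alice_wins unfolding k_def .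
    qed
  qed
qed

lemma eventually_lower:
  fixes p \<delta> \<epsilon> :: real
  assumes p: "0 < p" "p < 1" and \<delta>: "0 < \<delta>" "8 * \<delta> \<le> \<epsilon>" and M: "2 \<le> M"
  shows "\<forall>\<^sub>F n in sequentially. \<forall>E k \<sigma>. odd n \<longrightarrow> E \<subseteq> [{..<n}]\<^bsup>2\<^esup> \<longrightarrow>
    (\<forall>v<n. (p - \<delta>) * real n - 1 \<le> real (card (nbhd E v))) \<longrightarrow> scattered {..<n} E M (real n powr (5 / 4)) \<longrightarrow>
    private_nbrs {..<n} E (16 * cbrt n + 7) \<longrightarrow> real k < (p / 2 - \<epsilon>) * real n \<longrightarrow> \<not> winning_strategy {..<n} E k \<sigma>"
proof -
  have "\<forall>\<^sub>F n in sequentially. real n powr (5/4) \<le>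
      (\<delta> * real n - (real n powr (1/3) + 1) * (16 * (real n powr (1/3) + 1) + 7)) * real n powr (1/3)"
    using \<delta> by real_asymp
  \<comment> \<open>Degrees are at least \<open>(p - \<delta>) * n - 1\<close>, whereas
    \<open>2 * k\<close> is below \<open>(p - 16 * \<delta>) * n\<close>; the difference must cover
    the rest of \<open>degree\<close>.\<close>
  moreover have "\<forall>\<^sub>F n in sequentially. 16 * (real n powr (1/3) + 1) + 4 + \<delta> * real n + 1 \<le> 15 * \<delta> * real n - 1"
    using \<delta> by real_asymp
  ultimately show ?thesis using eventually_gt_at_top[of 0]
  proof eventually_elim
    case (elim n)
    let ?x = "real n"
    let ?V = "{..<n}"
    define z where "z = cbrt n"
    define r where "r = nat \<lceil>\<delta> * ?x\<rceil>"
    have x: "0 < ?x" using elim by simp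
    have z: "?x powr (1/3) \<le> real z" "real z \<le> ?x powr (1/3) + 1"
      unfolding z_def cbrt_def by (rule nat_ceiling_bounds; simp)+
    have r: "\<delta> * ?x \<le> real r" "real r \<le> \<delta> * ?x + 1"
      unfolding r_def using \<delta> x by (auto intro!: nat_ceiling_bounds)
    have r0: "0 < r" unfolding r_def using \<delta> x by simp
    show ?case
    proof (intro allI impI)
      fix E k \<sigma> assume odd: "odd n" and E: "E \<subseteq> [?V]\<^bsup>2\<^esup>"
        and deg: "\<forall>v<n. (p - \<delta>) * ?x - 1 \<le> real (card (nbhd E v))"
        and sc: "scattered ?V E M (?x powr (5/4))" and priv: "private_nbrs ?V E (16 * cbrt n + 7)"
        and k: "real k < (p / 2 - \<epsilon>) * ?x"
      interpret fin_graph ?V E by unfold_locales (simp, rule E)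
      interpret lower_graph ?V E k z r
      proof unfold_locales
        fix R \<T> assume "R \<subseteq> ?V" "r \<le> card R" "disjoint \<T>"
          "\<forall>T\<in>\<T>. \<exists>w\<in>?V. \<exists>w'\<in>?V. T = {w, w'} \<and> card (R - nbhd E w - nbhd E w' - {w, w'}) \<le> 16 * z + 5"
        then show "card \<T> < z"
        proof (rule few_flagged_if_scattered[OF sc M])
          have "real z * (16 * real z + 7) \<le> (?x powr (1/3) + 1) * (16 * (?x powr (1/3) + 1) + 7)"
            using z by (intro mult_mono) auto
          then have "\<delta> * ?x - (?x powr (1/3) + 1) * (16 * (?x powr (1/3) + 1) + 7) \<le> real r - real (z * (16 * z + 5 + 2))"
            using r by (simp add: algebra_simps)
          also have "\<dots> \<le> real (r - z * (16 * z + 5 + 2))" by linarith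
          finally have "(\<delta> * ?x - (?x powr (1/3) + 1) * (16 * (?x powr (1/3) + 1) + 7)) * ?x powr (1/3)
              \<le> real (r - z * (16 * z + 5 + 2)) * ?x powr (1/3)"
            by (intro mult_right_mono) auto
          also have "\<dots> \<le> real (r - z * (16 * z + 5 + 2)) * real z"
            using z(1) by (intro mult_left_mono) auto
          finally show "?x powr (5/4) \<le> real (r - z * (16 * z + 5 + 2)) * real z"
            using elim(1) by linarith
        qed
      next
        fix u assume "u \<in> ?V"
        then have u: "(p - \<delta>) * ?x - 1 \<le> real (card (nbhd E u))" using deg by simp
        have "8 * \<delta> * ?x \<le> \<epsilon> * ?x" using \<delta> x by (intro mult_right_mono) auto
        then have "real (2 * k + 16 * z + 4 + r) \<le> real (card (nbhd E u))"
          using u k z(2) r(2) elim(2) by (simp add: algebra_simps)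
        then show "2 * k + 16 * z + 4 + r \<le> card (nbhd E u)" by (simp only: of_nat_le_iff)
      next
        fix u w w' assume "u \<in> ?V" "w \<in> ?V - {u}" "w' \<in> ?V - {u}"
        then show "16 * z + 7 \<le> card (nbhd E u - nbhd E w - nbhd E w' - {w, w'})"
          using priv unfolding private_nbrs_def z_def by blast
      qed (rule r0)
      show "\<not> winning_strategy ?V E k \<sigma>" using bob_wins odd by simp
    qed
  qed
qed

section \<open>Random graphs are typical with high probability\<close>

lemma tendsto_prob_bad_degree:
  assumes p: "0 < p" "p < 1" and \<delta>: "0 < \<delta>"
  shows "(\<lambda>n. measure_pmf.prob (random_graph n p)
    {E. \<exists>v<n. \<delta> * (real n - 1) \<le> \<bar>real (card (nbhd E v)) - p * (real n - 1)\<bar>}) \<longlonglongrightarrow> 0"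
proof (rule Lim_null_comparison)
  show "(\<lambda>n. real n * (2 * exp (- 2 * (real n - 1) * \<delta>\<^sup>2))) \<longlonglongrightarrow> 0" using \<delta> by real_asymp
  show "\<forall>\<^sub>F n in sequentially. norm (measure_pmf.prob (random_graph n p)
    {E. \<exists>v<n. \<delta> * (real n - 1) \<le> \<bar>real (card (nbhd E v)) - p * (real n - 1)\<bar>})
    \<le> real n * (2 * exp (- 2 * (real n - 1) * \<delta>\<^sup>2))"
    using eventually_gt_at_top[of 1]
  proof eventually_elim
    case (elim n)
    let ?P = "measure_pmf.prob (random_graph n p)"
    let ?B = "\<lambda>v. {E. \<delta> * (real n - 1) \<le> \<bar>real (card (nbhd E v)) - p * (real n - 1)\<bar>}"
    have "?P {E. \<exists>v<n. \<delta> * (real n - 1) \<le> \<bar>real (card (nbhd E v)) - p * (real n - 1)\<bar>} = ?P (\<Union>v\<in>{..<n}. ?B v)"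
      by (intro arg_cong[where f = ?P]) auto
    also have "\<dots> \<le> (\<Sum>v<n. ?P (?B v))"
      by (intro measure_pmf.finite_measure_subadditive_finite) auto
    also have "\<dots> \<le> (\<Sum>v<n. 2 * exp (- 2 * (real n - 1) * \<delta>\<^sup>2))"
      using p \<delta> elim by (intro sum_mono random_graph_degree) auto
    finally show ?case by simp
  qed
qed

lemma tendsto_prob_not_scattered:
  assumes p: "0 < p" "p < 1" and M: "0 < M"
  shows "(\<lambda>n. measure_pmf.prob (random_graph n p) {E. \<not> scattered {..<n} E M (real n powr (5/4))}) \<longlonglongrightarrow> 0"
proof (rule Lim_null_comparison)
  let ?b = "1 - min p (1 - p) ^ M"
  define g where "g = - ln ?b"
  have "0 < min p (1 - p) ^ M" using p by simp
  moreover have b0: "0 < ?b" using p M by (simp add: power_less_one_iff min_less_iff_disj)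
  ultimately have g: "0 < g" by (simp add: g_def)
  show "(\<lambda>n. exp (real n * ln 2 + real n * ln (real n + 1) - real n powr (5/4) * g)) \<longlonglongrightarrow> 0"
    using g by real_asymp
  show "\<forall>\<^sub>F n in sequentially. norm (measure_pmf.prob (random_graph n p) {E. \<not> scattered {..<n} E M (real n powr (5/4))})
    \<le> exp (real n * ln 2 + real n * ln (real n + 1) - real n powr (5/4) * g)"
  proof (intro always_eventually allI)
    fix n
    have "2 ^ n * real (n + 1) ^ n * ?b powr (real n powr (5/4))
      = exp (real n * ln 2) * exp (real n * ln (real n + 1)) * exp (real n powr (5/4) * ln ?b)"
      using b0 by (simp add: powr_def exp_of_nat_mult add.commute)
    also have "\<dots> = exp (real n * ln 2 + real n * ln (real n + 1) - real n powr (5/4) * g)"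
      by (simp add: g_def exp_add exp_diff exp_minus field_simps)
    finally show "norm (measure_pmf.prob (random_graph n p) {E. \<not> scattered {..<n} E M (real n powr (5/4))})
      \<le> exp (real n * ln 2 + real n * ln (real n + 1) - real n powr (5/4) * g)"
      using prob_not_scattered[OF p M, of n "real n powr (5/4)"] by simp
  qed
qed

lemma tendsto_prob_not_private_nbrs:
  assumes p: "0 < p" "p < 1"
  shows "(\<lambda>n. measure_pmf.prob (random_graph n p) {E. \<not> private_nbrs {..<n} E (16 * cbrt n + 7)}) \<longlonglongrightarrow> 0"
proof (rule Lim_null_comparison)
  let ?b = "1 - min p (1 - p) ^ 3"
  define g where "g = - ln ?b"
  have "0 < min p (1 - p) ^ 3" using p by simp
  moreover have b0: "0 < ?b" using p by (simp add: power_less_one_iff min_less_iff_disj)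
  ultimately have g: "0 < g" by (simp add: g_def)
  let ?u = "\<lambda>n. real n ^ 3 * (16 * (real n powr (1/3) + 1) + 7) * exp (- g * (real n powr (1/2) - 4))"
  show "?u \<longlonglongrightarrow> 0" using g by real_asymp
  have "\<forall>\<^sub>F n in sequentially. (16 * (real n powr (1/3) + 1) + 7) * real n powr (1/2) \<le> real n" by real_asymp
  then show "\<forall>\<^sub>F n in sequentially. norm (measure_pmf.prob (random_graph n p) {E. \<not> private_nbrs {..<n} E (16 * cbrt n + 7)}) \<le> ?u n"
  proof eventually_elim
    case (elim n)
    define s where "s = nat \<lfloor>real n powr (1/2)\<rfloor>"
    have s: "real s \<le> real n powr (1/2)" "real n powr (1/2) - 1 \<le> real s"
      unfolding s_def by (rule nat_floor_bounds; simp)+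
    have z: "real (cbrt n) \<le> real n powr (1/3) + 1"
      unfolding cbrt_def by (rule nat_ceiling_bounds) simp
    have "real ((16 * cbrt n + 7) * s) \<le> (16 * (real n powr (1/3) + 1) + 7) * real n powr (1/2)"
      using z s by (simp only: of_nat_mult) (intro mult_mono, auto)
    then have "real ((16 * cbrt n + 7) * s) \<le> real n" using elim by linarith
    then have "(16 * cbrt n + 7) * s \<le> n" by (simp only: of_nat_le_iff)
    from prob_not_private_nbrs[OF p this]
    have "measure_pmf.prob (random_graph n p) {E. \<not> private_nbrs {..<n} E (16 * cbrt n + 7)}
      \<le> real n ^ 3 * real (16 * cbrt n + 7) * ?b ^ (s - 3)" .
    also have "?b ^ (s - 3) = exp (- g * real (s - 3))"
      using b0 by (simp add: g_def powr_realpow [symmetric] powr_def)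
    also have "\<dots> \<le> exp (- g * (real n powr (1/2) - 4))"
    proof -
      \<comment> \<open>The 4 consists of 1 for rounding \<open>s\<close> down and 3 for the
        excluded vertices of a chunk.\<close>
      have "real n powr (1/2) - 4 \<le> real (s - 3)" using s(2) by linarith
      then have "g * (real n powr (1/2) - 4) \<le> g * real (s - 3)" using g by (intro mult_left_mono) auto
      then show ?thesis by simp
    qed
    also have "real n ^ 3 * real (16 * cbrt n + 7) * exp (- g * (real n powr (1/2) - 4)) \<le> ?u n"
      using z by (intro mult_right_mono mult_left_mono) auto
    finally show ?case by (simp add: mult_left_mono)
  qed
qed

theorem theorem1:
  fixes p :: real
  assumes "0 < p" and "p < 1"
  shows "\<forall>\<epsilon>>0. ((\<lambda>n. measure_pmf.prob (random_graph n p)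
            {E. \<bar>real (eternal_game_chromatic_number {..<n} E) - p * real n / 2\<bar> \<le> \<epsilon> * real n})
          \<longlongrightarrow> 1) (inf sequentially (principal {n. odd n}))"
proof (intro allI impI)
  fix \<epsilon> :: real assume \<epsilon>: "0 < \<epsilon>"
  define \<delta> where "\<delta> = min (\<epsilon> / 8) (1 / 2)"
  \<comment> \<open>Classes with more than \<open>4 / \<delta>\<close> vertices number at most
    \<open>\<delta> * n / 4\<close>, a fraction of the palette; at least 2 is needed to admit Bob's
    pairs.\<close>
  define M where "M = nat \<lceil>4 / \<delta>\<rceil> + 2"
  have \<delta>: "0 < \<delta>" "\<delta> \<le> 1 / 2" "8 * \<delta> \<le> \<epsilon>" using \<epsilon> by (auto simp: \<delta>_def)
  have M: "4 / \<delta> \<le> real M" "2 \<le> M" "0 < M" unfolding M_def using \<delta> by linarith+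
  let ?P = "\<lambda>n. measure_pmf.prob (random_graph n p)"
  let ?G = "\<lambda>n. {E. \<bar>real (eternal_game_chromatic_number {..<n} E) - p * real n / 2\<bar> \<le> \<epsilon> * real n}"
  let ?D = "\<lambda>n. {E. \<exists>v<n. \<delta> * (real n - 1) \<le> \<bar>real (card (nbhd E v)) - p * (real n - 1)\<bar>}"
  let ?S = "\<lambda>n. {E. \<not> scattered {..<n} E M (real n powr (5/4))}"
  let ?N = "\<lambda>n. {E. \<not> private_nbrs {..<n} E (16 * cbrt n + 7)}"
  have "(\<lambda>n. 1 - (?P n (?D n) + (?P n (?S n) + ?P n (?N n)))) \<longlonglongrightarrow> 1 - (0 + (0 + 0))"
    using assms \<delta> M
    by (intro tendsto_intros tendsto_prob_bad_degree tendsto_prob_not_scattered tendsto_prob_not_private_nbrs) auto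
  then have lim: "((\<lambda>n. 1 - (?P n (?D n) + (?P n (?S n) + ?P n (?N n)))) \<longlongrightarrow> 1) (inf sequentially (principal {n. odd n}))"
    by (simp add: tendsto_mono[OF inf_le1])
  have "\<forall>\<^sub>F n in sequentially. odd n \<longrightarrow> 1 - (?P n (?D n) + (?P n (?S n) + ?P n (?N n))) \<le> ?P n (?G n)"
    using eventually_upper[OF assms \<delta> M(1)] eventually_lower[OF assms \<delta>(1,3) M(2)] eventually_gt_at_top[of 1]
  proof eventually_elim
    case (elim n)
    show ?case
    proof
      assume odd: "odd n"
      have sub: "(UNIV - ?G n) \<inter> set_pmf (random_graph n p) \<subseteq> ?D n \<union> (?S n \<union> ?N n)"
      proof
        fix E assume E: "E \<in> (UNIV - ?G n) \<inter> set_pmf (random_graph n p)"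
        then have E2: "E \<subseteq> [{..<n}]\<^bsup>2\<^esup>" by (auto simp: random_graph_def)
        show "E \<in> ?D n \<union> (?S n \<union> ?N n)"
        proof (rule ccontr)
          assume "E \<notin> ?D n \<union> (?S n \<union> ?N n)"
          then have D: "\<And>v. v < n \<Longrightarrow> \<bar>real (card (nbhd E v)) - p * (real n - 1)\<bar> < \<delta> * (real n - 1)"
            and S: "scattered {..<n} E M (real n powr (5/4))" and N: "private_nbrs {..<n} E (16 * cbrt n + 7)"
            by (auto simp: not_le)
          have up: "real (card (nbhd E v)) \<le> (p + \<delta>) * real n" if "v < n" for v
            using D[OF that] assms \<delta> by (simp add: algebra_simps abs_less_iff)
          \<comment> \<open>Degrees concentrate around \<open>p * (n - 1)\<close>; the 1 covers the
            passage to \<open>n\<close>.\<close>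
          have low: "(p - \<delta>) * real n - 1 \<le> real (card (nbhd E v))" if "v < n" for v
            using D[OF that] assms \<delta> by (simp add: algebra_simps abs_less_iff)
          let ?k = "eternal_game_chromatic_number {..<n} E"
          let ?m = "nat \<lfloor>(p / 2 + \<epsilon>) * real n\<rfloor>"
          \<comment> \<open>Used twice: it bounds the least number from above, and it makes that
            number itself winning, to which Bob's strategy then applies.\<close>
          have ex: "\<exists>\<sigma>. winning_strategy {..<n} E ?m \<sigma>" using elim(1) E2 up S by blast
          have "?k \<le> ?m" unfolding eternal_game_chromatic_number_def
            by (rule Least_le[where P = "\<lambda>k. \<exists>\<sigma>. winning_strategy {..<n} E k \<sigma>", OF ex])
          then have "real ?k \<le> real ?m" by simp
          also have "\<dots> \<le> (p / 2 + \<epsilon>) * real n" using assms \<epsilon> by (intro nat_floor_bounds) auto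
          finally have 1: "real ?k \<le> (p / 2 + \<epsilon>) * real n" .
          have "\<exists>\<sigma>. winning_strategy {..<n} E ?k \<sigma>"
            unfolding eternal_game_chromatic_number_def
            by (rule LeastI[where P = "\<lambda>k. \<exists>\<sigma>. winning_strategy {..<n} E k \<sigma>", OF ex])
          then have "\<not> real ?k < (p / 2 - \<epsilon>) * real n" using elim(2) odd E2 low S N by blast
          with 1 have "E \<in> ?G n" by (simp add: abs_le_iff algebra_simps)
          then show False using E by simp
        qed
      qed
      have "1 - ?P n (?G n) = ?P n (UNIV - ?G n)"
        using measure_pmf.prob_compl[of "?G n" "random_graph n p"] by simp
      also have "\<dots> = ?P n ((UNIV - ?G n) \<inter> set_pmf (random_graph n p))"
        by (rule measure_Int_set_pmf [symmetric])
      also have "\<dots> \<le> ?P n (?D n \<union> (?S n \<union> ?N n))"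
        using sub by (intro measure_pmf.finite_measure_mono) auto
      also have "\<dots> \<le> ?P n (?D n) + ?P n (?S n \<union> ?N n)"
        by (intro measure_Un_le) auto
      also have "\<dots> \<le> ?P n (?D n) + (?P n (?S n) + ?P n (?N n))"
        by (intro add_left_mono measure_Un_le) auto
      finally show "1 - (?P n (?D n) + (?P n (?S n) + ?P n (?N n))) \<le> ?P n (?G n)" by linarith
    qed
  qed
  then have "\<forall>\<^sub>F n in inf sequentially (principal {n. odd n}). 1 - (?P n (?D n) + (?P n (?S n) + ?P n (?N n))) \<le> ?P n (?G n)"
    by (simp add: eventually_inf_principal)
  moreover have "\<forall>\<^sub>F n in inf sequentially (principal {n. odd n}). ?P n (?G n) \<le> 1"
    by (intro always_eventually allI measure_pmf.prob_le_1)
  ultimately show "((\<lambda>n. ?P n (?G n)) \<longlongrightarrow> 1) (inf sequentially (principal {n. odd n}))"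
    by (rule tendsto_sandwich[OF _ _ lim tendsto_const])
qed

end
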